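(* Let $n\ge 2$ and $d\ge 2$ be integers, and let $\Upsilon$ be the Choi state of an $n$-step process tensor (as defined in the context). Then $$\mathrm{M}\le 2n\ln d-\frac{2^n-1}{2^n-2}\,\mathrm{N}.$$
   Context: An $n$-step process tensor with system dimension $d$ is represented by its Choi state $\Upsilon$, a density operator on $\mathcal{H}_{\mathrm{i}_0}\otimes\mathcal{H}_{\mathrm{o}_1}\otimes\cdots\otimes\mathcal{H}_{\mathrm{i}_{n-1}}\otimes\mathcal{H}_{\mathrm{o}_n}$ (each factor of dimension $d$) satisfying: for all $1\le j\le n$, $\mathrm{tr}_{\mathrm{o}_j}[\Upsilon_{1:j}]=\Upsilon_{1:j-1}\otimes\mathbb{I}_{\mathrm{i}_{j-1}}/d$, where $\Upsilon_{1:j}$ is the partial trace of $\Upsilon$ over $\mathrm{i}_j,\mathrm{o}_{j+1},\dots,\mathrm{i}_{n-1},\mathrm{o}_n$ (with $\Upsilon_{1:n}=\Upsilon$, $\Upsilon_{1:0}=1$). Entropies are von Neumann with natural log; $S_{\mathrm{i}_{j-1}},S_{\mathrm{o}_j}$ are single-factor marginal entropies of $\Upsilon$, $S_j$ the entropy of its marginal on $\mathrm{i}_{j-1}\mathrm{o}_j$, $S_{1:n}=S(\Upsilon)$. Total Markovian correlations: $\mathrm{M}=\sum_{j=1}^n(S_{\mathrm{i}_{j-1}}+S_{\mathrm{o}_j}-S_j)$; non-Markovian correlations: $\mathrm{N}=\sum_{j=1}^n S_j-S_{1:n}$. *)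

theory Defs
  imports "Jordan_Normal_Form.Char_Poly"
begin

text \<open>Multipartite systems: k tensor factors, each of dimension d, total dimension d^k.
  A basis index i < d^k is identified with its base-d digit string; factor m (0 \<le> m < k)
  corresponds to the m-th most significant digit.\<close>

definition digit :: "nat \<Rightarrow> nat \<Rightarrow> nat \<Rightarrow> nat \<Rightarrow> nat" where
  "digit d k m i = i div d ^ (k - 1 - m) mod d"

definition restrict_idx :: "nat \<Rightarrow> nat \<Rightarrow> nat set \<Rightarrow> nat \<Rightarrow> nat" where
  "restrict_idx d k K i =
     (let ks = sorted_list_of_set K
      in \<Sum>j<length ks. digit d k (ks ! j) i * d ^ (length ks - 1 - j))"

definition marginal :: "nat \<Rightarrow> nat \<Rightarrow> nat set \<Rightarrow> complex mat \<Rightarrow> complex mat" where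
  "marginal d k K \<rho> = mat (d ^ card K) (d ^ card K) (\<lambda>(a, b).
     \<Sum>i<d ^ k. \<Sum>j<d ^ k.
       if restrict_idx d k K i = a \<and> restrict_idx d k K j = b \<and>
          (\<forall>m<k. m \<notin> K \<longrightarrow> digit d k m i = digit d k m j)
       then \<rho> $$ (i, j) else 0)"

definition tensor_maxmixed :: "nat \<Rightarrow> complex mat \<Rightarrow> complex mat" where
  "tensor_maxmixed d A = mat (dim_row A * d) (dim_col A * d) (\<lambda>(a, b).
     A $$ (a div d, b div d) * (if a mod d = b mod d then 1 / of_nat d else 0))"

definition density_operator :: "nat \<Rightarrow> complex mat \<Rightarrow> bool" where
  "density_operator N \<rho> \<longleftrightarrow> \<rho> \<in> carrier_mat N N
     \<and> (\<forall>i<N. \<forall>j<N. \<rho> $$ (i, j) = cnj (\<rho> $$ (j, i)))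
     \<and> (\<forall>v \<in> carrier_vec N. let q = conjugate v \<bullet> (\<rho> *\<^sub>v v) in Im q = 0 \<and> Re q \<ge> 0)
     \<and> (\<Sum>i<N. \<rho> $$ (i, i)) = 1"

definition eigvals :: "complex mat \<Rightarrow> complex list" where
  "eigvals A = (SOME as. length as = dim_row A \<and> char_poly A = (\<Prod>a\<leftarrow>as. [:- a, 1:]))"

definition eta :: "real \<Rightarrow> real" where
  "eta x = (if x \<le> 0 then 0 else - x * ln x)"

definition vn_entropy :: "complex mat \<Rightarrow> real" where
  "vn_entropy \<rho> = (\<Sum>l\<leftarrow>eigvals \<rho>. eta (Re l))"

text \<open>Factor layout of an n-step process tensor: 2n factors i_0, o_1, i_1, o_2, ..., i_{n-1}, o_n;
  input i_m is factor 2m, output o_m is factor 2m - 1.\<close>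
definition in_fac :: "nat \<Rightarrow> nat" where "in_fac m = 2 * m"
definition out_fac :: "nat \<Rightarrow> nat" where "out_fac m = 2 * m - 1"

definition ups_upto :: "nat \<Rightarrow> nat \<Rightarrow> complex mat \<Rightarrow> nat \<Rightarrow> complex mat" where
  "ups_upto d n \<Upsilon> j = marginal d (2 * n) {0..<2 * j} \<Upsilon>"

definition process_tensor :: "nat \<Rightarrow> nat \<Rightarrow> complex mat \<Rightarrow> bool" where
  "process_tensor d n \<Upsilon> \<longleftrightarrow> density_operator (d ^ (2 * n)) \<Upsilon> \<and>
     (\<forall>j \<in> {1..n}.
        marginal d (2 * j) ({0..<2 * j} - {out_fac j}) (ups_upto d n \<Upsilon> j)
          = tensor_maxmixed d (if j = 1 then 1\<^sub>m 1 else ups_upto d n \<Upsilon> (j - 1)))"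

definition ent :: "nat \<Rightarrow> nat \<Rightarrow> complex mat \<Rightarrow> nat set \<Rightarrow> real" where
  "ent d n \<Upsilon> K = vn_entropy (marginal d (2 * n) K \<Upsilon>)"

definition markov_corr :: "nat \<Rightarrow> nat \<Rightarrow> complex mat \<Rightarrow> real" where
  "markov_corr d n \<Upsilon> = (\<Sum>j = 1..n.
      ent d n \<Upsilon> {in_fac (j - 1)} + ent d n \<Upsilon> {out_fac j}
      - ent d n \<Upsilon> {in_fac (j - 1), out_fac j})"

definition nonmarkov_corr :: "nat \<Rightarrow> nat \<Rightarrow> complex mat \<Rightarrow> real" where
  "nonmarkov_corr d n \<Upsilon> = (\<Sum>j = 1..n. ent d n \<Upsilon> {in_fac (j - 1), out_fac j}) - vn_entropy \<Upsilon>"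

end

theory Submission
  imports Defs "Jordan_Normal_Form.Schur_Decomposition"
begin

text \<open>
  Write $S_{1:j}$ for the entropy of $\Upsilon_{1:j}$. Causality makes the input $i_{j-1}$ maximally
  mixed and uncorrelated with the past, so the Araki--Lieb inequality gives
  $S_{1:j-1} + \ln d \le S_{o_j} + S_{1:j} \le \ln d + S_{1:j}$: the entropies $S_{1:j}$ increase with $j$.
  Araki--Lieb once more yields $S_j \le S_{1:j-1} + S_{1:j} \le 2 S_{1:n}$ for $j \ge 2$, and $S_1 \le S_{1:n}$,
  hence $N \le (2n - 2) S_{1:n} \le (2^n - 2) S_{1:n}$. Since all single-factor entropies are at most
  $\ln d$, also $M + N \le 2n \ln d - S_{1:n}$, and the two bounds combine to the claim.

  Araki--Lieb is obtained without purification. Decomposing the eigenvectors of $\rho_{AB}$ along an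
  eigenbasis of $\rho_B$ exhibits $\rho_A$ as a mixture of pure states whose weights form a joint distribution
  with marginals $\mathrm{spec}(\rho_B)$ and $\mathrm{spec}(\rho_{AB})$; the entropy of a mixture of pure
  states is at most the Shannon entropy of its weights, which is subadditive.
\<close>

section \<open>Spectral decomposition\<close>

lemma sum_rotate:
  "(\<Sum>a\<in>A. \<Sum>b\<in>B. \<Sum>c\<in>C. f a b c) = (\<Sum>b\<in>B. \<Sum>c\<in>C. \<Sum>a\<in>A. f a b c)"
  by (subst sum.swap, intro sum.cong refl, rule sum.swap)

lemma sum_swap_pairs:
  "(\<Sum>a\<in>A. \<Sum>b\<in>B. \<Sum>c\<in>C. \<Sum>e\<in>E. f a b c e) = (\<Sum>c\<in>C. \<Sum>e\<in>E. \<Sum>a\<in>A. \<Sum>b\<in>B. f a b c e)"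
  by (rule trans[OF sum.cong[OF refl sum_rotate] sum_rotate])

text \<open>Vectors are plain functions on an index set, and the family may be smaller than the
  space or indexed by pairs. Bessel's inequality is later applied to such a family, with coordinates
  labelled by \<open>J \<times> K\<close>.\<close>

definition orthonormal :: "'k set \<Rightarrow> 'i set \<Rightarrow> ('k \<Rightarrow> 'i \<Rightarrow> complex) \<Rightarrow> bool" where
  "orthonormal K I u \<longleftrightarrow>
     (\<forall>k\<in>K. \<forall>l\<in>K. (\<Sum>i\<in>I. u k i * cnj (u l i)) = (if k = l then 1 else 0))"

lemma orthonormalD:
  assumes "orthonormal K I u" "k \<in> K" "l \<in> K"
  shows "(\<Sum>i\<in>I. u k i * cnj (u l i)) = (if k = l then 1 else 0)"
  using assms unfolding orthonormal_def by blast

text \<open>With n vectors in dimension n, the relations between rows say that \<open>U * V\<close>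
  is the identity. A one-sided inverse of a square matrix is two-sided, and \<open>V * U\<close>
  being the identity is the completeness relation.\<close>

lemma orthonormal_complete:
  assumes "orthonormal {..<n} {..<n::nat} u" "i < n" "j < n"
  shows "(\<Sum>k<n. u k i * cnj (u k j)) = (if i = j then 1 else 0)"
proof -
  define U where "U = mat n n (\<lambda>(k, i). u k i)"
  define V where "V = mat n n (\<lambda>(i, k). cnj (u k i))"
  have U: "U \<in> carrier_mat n n" and V: "V \<in> carrier_mat n n" by (auto simp: U_def V_def)
  have "U * V = 1\<^sub>m n"
    by (rule eq_matI) (use orthonormalD[OF assms(1)] in
        \<open>auto simp: U_def V_def scalar_prod_def atLeast0LessThan\<close>)
  from mat_mult_left_right_inverse[OF U V this] have "V * U = 1\<^sub>m n" .
  then have "(V * U) $$ (j, i) = 1\<^sub>m n $$ (j, i)" by simp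
  then show ?thesis
    using assms(2,3) by (auto simp: U_def V_def scalar_prod_def atLeast0LessThan mult.commute)
qed

text \<open>The characteristic polynomial splits over the complex numbers, so an eigenvector exists.
  It is completed to a basis, and Gram-Schmidt leaves the first vector of the list unchanged. This
  is the deflation step for \<open>spectral_ex\<close>.\<close>

lemma orthonormal_basis_with_eigenvector:
  assumes A: "A \<in> carrier_mat n n" and n: "n > 0"
  obtains e w where "orthonormal {..<n} {..<n} w"
    and "\<And>i. i < n \<Longrightarrow> (\<Sum>j<n. A $$ (i, j) * w 0 j) = e * w 0 i"
proof -
  obtain es where es: "char_poly A = (\<Prod>a\<leftarrow>es. [:- a, 1:])" "length es = n"
    using char_poly_factorized[OF A] by blast
  then obtain e es' where "es = e # es'" using n by (cases es) auto
  then have "poly (char_poly A) e = 0" using es by simp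
  then have "eigenvalue A e" using eigenvalue_root_char_poly[OF A] by simp
  then obtain v where "eigenvector A v e" unfolding eigenvalue_def by blast
  then have v: "v \<in> carrier_vec n" and v0: "v \<noteq> 0\<^sub>v n" and Av: "A *\<^sub>v v = e \<cdot>\<^sub>v v"
    using A unfolding eigenvector_def by auto
  define b where "b = basis_completion v"
  define ws where "ws = gram_schmidt n b"
  interpret cof_vec_space n "TYPE(complex)" .
  from basis_completion[OF v v0, folded b_def]
  have dist_b: "distinct b" and indep: "\<not> lin_dep (set b)" and b: "set b \<subseteq> carrier_vec n"
    and hdb: "hd b = v" and len_b: "length b = n" by auto
  from hdb len_b n obtain vs where bv: "b = v # vs" by (cases b) auto
  from gram_schmidt_result[OF b dist_b indep refl, folded ws_def]
  have ws: "set ws \<subseteq> carrier_vec n" "corthogonal ws" "length ws = n"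
    by (auto simp: len_b)
  have "hd ws = v" using gram_schmidt_hd[OF v, of vs, folded bv] unfolding ws_def .
  then have ws0: "ws ! 0 = v" using ws n by (cases ws) auto
  \<comment> \<open>The Gram-Schmidt vectors are orthogonal but not normalised; \<open>r k\<close>
    is the squared length to divide out.\<close>
  define r where "r k = (\<Sum>i<n. (cmod (ws ! k $ i))\<^sup>2)" for k
  define w where "w k i = ws ! k $ i / complex_of_real (sqrt (r k))" for k i
  have dim: "dim_vec (ws ! k) = n" if "k < n" for k
    using ws that by (metis carrier_vecD nth_mem subsetD)
  have sp: "(ws ! k) \<bullet>c (ws ! l) = (\<Sum>i<n. ws ! k $ i * cnj (ws ! l $ i))" if "k < n" "l < n" for k l
    using dim that by (auto simp: scalar_prod_def atLeast0LessThan)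
  have rr: "(\<Sum>i<n. ws ! k $ i * cnj (ws ! k $ i)) = complex_of_real (r k)" for k
    unfolding r_def by (simp add: complex_norm_square[symmetric])
  have rpos: "r k > 0" if "k < n" for k
  proof -
    have "(ws ! k) \<bullet>c (ws ! k) \<noteq> 0" using corthogonalD[OF ws(2)] ws(3) that by simp
    then have "r k \<noteq> 0" using sp[OF that that] rr by simp
    moreover have "r k \<ge> 0" unfolding r_def by (intro sum_nonneg) simp
    ultimately show ?thesis by simp
  qed
  have "orthonormal {..<n} {..<n} w"
    unfolding orthonormal_def
  proof (intro ballI)
    fix k l assume kl: "k \<in> {..<n}" "l \<in> {..<n}"
    have "(\<Sum>i<n. w k i * cnj (w l i))
        = (\<Sum>i<n. ws ! k $ i * cnj (ws ! l $ i)) / (complex_of_real (sqrt (r k)) * complex_of_real (sqrt (r l)))"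
      unfolding w_def by (simp add: sum_divide_distrib)
    also have "\<dots> = (if k = l then 1 else 0)"
    proof (cases "k = l")
      case True
      have "complex_of_real (sqrt (r l)) * complex_of_real (sqrt (r l)) = complex_of_real (r l)"
        using rpos[of l] kl by (simp flip: of_real_mult)
      then show ?thesis using True rr[of l] rpos[of l] kl by simp
    next
      case False
      have "(ws ! k) \<bullet>c (ws ! l) = 0" using corthogonalD[OF ws(2)] ws(3) kl False by simp
      then show ?thesis using sp kl False by simp
    qed
    finally show "(\<Sum>i<n. w k i * cnj (w l i)) = (if k = l then 1 else 0)" .
  qed
  moreover have "(\<Sum>j<n. A $$ (i, j) * w 0 j) = e * w 0 i" if "i < n" for i
  proof -
    have "(A *\<^sub>v v) $ i = (\<Sum>j<n. A $$ (i, j) * v $ j)"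
      using A v that by (auto simp: scalar_prod_def atLeast0LessThan)
    then have "(\<Sum>j<n. A $$ (i, j) * v $ j) = e * v $ i" using Av v that by simp
    then show ?thesis unfolding w_def ws0 by (simp flip: sum_divide_distrib)
  qed
  ultimately show thesis by (rule that)
qed

text \<open>The decomposition of A into rank-one terms p_k |u_k><u_k| with real eigenvalues, listed
  with multiplicity and in no particular order.\<close>

definition spectral :: "nat \<Rightarrow> complex mat \<Rightarrow> (nat \<Rightarrow> real) \<Rightarrow> (nat \<Rightarrow> nat \<Rightarrow> complex) \<Rightarrow> bool" where
  "spectral n A p u \<longleftrightarrow> A \<in> carrier_mat n n \<and> orthonormal {..<n} {..<n} u \<and>
     (\<forall>i<n. \<forall>j<n. A $$ (i, j) = (\<Sum>k<n. of_real (p k) * u k i * cnj (u k j)))"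

text \<open>Induction on the dimension. In an orthonormal basis starting with an eigenvector, a
  Hermitian matrix is block diagonal with blocks of size 1 and m. The induction hypothesis
  diagonalises the large block.\<close>

lemma spectral_ex:
  assumes "A \<in> carrier_mat n n"
    and "\<And>i j. i < n \<Longrightarrow> j < n \<Longrightarrow> A $$ (i, j) = cnj (A $$ (j, i))"
  shows "\<exists>p u. spectral n A p u"
  using assms
proof (induction n arbitrary: A)
  case 0
  then show ?case by (auto simp: spectral_def orthonormal_def)
next
  case (Suc m)
  let ?n = "Suc m"
  note A = Suc.prems(1) and herm = Suc.prems(2)
  obtain e w where w: "orthonormal {..<?n} {..<?n} w"
    and ev: "\<And>i. i < ?n \<Longrightarrow> (\<Sum>j<?n. A $$ (i, j) * w 0 j) = e * w 0 i"
    using orthonormal_basis_with_eigenvector[OF A] by blast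
  \<comment> \<open>The matrix of A in the basis \<open>w\<close>, with entries <w_a, A
    w_b>.\<close>
  define B where "B a b = (\<Sum>i<?n. \<Sum>j<?n. cnj (w a i) * A $$ (i, j) * w b j)" for a b
  have Bherm: "B a b = cnj (B b a)" for a b
  proof -
    have "cnj (B b a) = (\<Sum>i<?n. \<Sum>j<?n. w b i * cnj (A $$ (i, j)) * cnj (w a j))"
      unfolding B_def by simp
    also have "\<dots> = (\<Sum>i<?n. \<Sum>j<?n. w b i * A $$ (j, i) * cnj (w a j))"
      by (intro sum.cong refl) (simp add: herm[symmetric])
    also have "\<dots> = B a b"
      unfolding B_def by (subst sum.swap) (simp add: mult_ac)
    finally show ?thesis by simp
  qed
  have B0: "B a 0 = (if a = 0 then e else 0)" if "a < ?n" for a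
  proof -
    have "B a 0 = (\<Sum>i<?n. cnj (w a i) * (\<Sum>j<?n. A $$ (i, j) * w 0 j))"
      unfolding B_def by (simp only: sum_distrib_left mult.assoc)
    also have "\<dots> = (\<Sum>i<?n. cnj (w a i) * (e * w 0 i))"
      by (intro sum.cong refl) (use ev in auto)
    also have "\<dots> = e * (\<Sum>i<?n. w 0 i * cnj (w a i))"
      by (simp only: sum_distrib_left mult_ac)
    finally show ?thesis using orthonormalD[OF w, of 0 a] that by auto
  qed
  \<comment> \<open>Hermiticity carries the vanishing of the first column over to the first
    row.\<close>
  have B0': "B 0 a = (if a = 0 then e else 0)" if "a < ?n" for a
  proof (cases "a = 0")
    case True then show ?thesis using B0[of 0] by simp
  next
    case False then show ?thesis by (subst Bherm) (simp add: B0[OF that])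
  qed
  have e_real: "e = of_real (Re e)"
    using arg_cong[OF Bherm[of 0 0], of Im] B0[of 0] by (simp add: complex_eq_iff)
  \<comment> \<open>Return from \<open>B\<close> to \<open>A\<close>: substituting the definition of
    \<open>B\<close> leaves a completeness relation of \<open>w\<close> on either side of
    \<open>A\<close>.\<close>
  have AB: "A $$ (i, j) = (\<Sum>a<?n. \<Sum>b<?n. w a i * B a b * cnj (w b j))" if ij: "i < ?n" "j < ?n" for i j
  proof -
    have "(\<Sum>a<?n. \<Sum>b<?n. w a i * B a b * cnj (w b j))
        = (\<Sum>a<?n. \<Sum>b<?n. \<Sum>i'<?n. \<Sum>j'<?n. (w a i * cnj (w a i')) * A $$ (i', j') * (w b j' * cnj (w b j)))"
      unfolding B_def by (simp only: sum_distrib_left sum_distrib_right mult_ac)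
    also have "\<dots> = (\<Sum>i'<?n. \<Sum>j'<?n. \<Sum>a<?n. \<Sum>b<?n. (w a i * cnj (w a i')) * A $$ (i', j') * (w b j' * cnj (w b j)))"
      by (rule sum_swap_pairs)
    also have "\<dots> = (\<Sum>i'<?n. \<Sum>j'<?n. (\<Sum>a<?n. w a i * cnj (w a i')) * A $$ (i', j') * (\<Sum>b<?n. w b j' * cnj (w b j)))"
      by (simp only: sum_distrib_left sum_distrib_right) 
        (rule sum.cong[OF refl], rule sum.cong[OF refl], rule sum.swap)
    also have "\<dots> = (\<Sum>i'<?n. \<Sum>j'<?n. (if i = i' then 1 else 0) * A $$ (i', j') * (if j' = j then 1 else 0))"
      by (intro sum.cong refl arg_cong2[where f = "(*)"] orthonormal_complete[OF w])
        (use ij in auto)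
    also have "\<dots> = A $$ (i, j)"
    proof -
      have "(if i = i' then 1 else 0) * A $$ (i', j') * (if j' = j then 1 else 0)
          = (if i' = i then if j' = j then A $$ (i', j') else 0 else 0)" for i' j' by simp
      then have "(\<Sum>i'<?n. \<Sum>j'<?n. (if i = i' then 1 else 0) * A $$ (i', j') * (if j' = j then 1 else 0))
        = (\<Sum>i'<?n. if i' = i then (\<Sum>j'<?n. if j' = j then A $$ (i', j') else 0) else 0)"
        by (intro sum.cong refl) auto
      then show ?thesis using ij by (simp only: sum.delta finite_lessThan lessThan_iff if_True)
    qed
    finally show ?thesis by simp
  qed
  define C where "C = mat m m (\<lambda>(a, b). B (Suc a) (Suc b))"
  have "\<exists>p u. spectral m C p u"
  proof (rule Suc.IH)
    fix i j assume "i < m" "j < m"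
    then show "C $$ (i, j) = cnj (C $$ (j, i))"
      using Bherm[of "Suc i" "Suc j"] unfolding C_def by (simp only: index_mat split)
  qed (simp add: C_def)
  then obtain p u where u: "orthonormal {..<m} {..<m} u"
    and C: "\<And>i j. i < m \<Longrightarrow> j < m \<Longrightarrow> C $$ (i, j) = (\<Sum>k<m. of_real (p k) * u k i * cnj (u k j))"
    unfolding spectral_def by blast
  define p' where "p' = case_nat (Re e) p"
  \<comment> \<open>Eigenvectors of the block \<open>C\<close> are coordinate vectors relative to
    w_1, ..., w_m; they are expanded back into the original coordinates, and the eigenvector
    \<open>w 0\<close> is put in front.\<close>
  define u' where "u' = case_nat (w 0) (\<lambda>k i. \<Sum>a<m. u k a * w (Suc a) i)"
  have ip: "(\<Sum>i<?n. w a i * cnj (w b i)) = (if a = b then 1 else 0)" if "a < ?n" "b < ?n" for a b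
    using orthonormalD[OF w] that by simp
  have "(\<Sum>i<?n. u' k i * cnj (u' l i)) = (if k = l then 1 else 0)" if kl: "k < ?n" "l < ?n" for k l
  proof -
    have cross: "(\<Sum>i<?n. w 0 i * cnj (u' (Suc l) i)) = 0" if "l < m" for l
    proof -
      have "(\<Sum>i<?n. w 0 i * cnj (u' (Suc l) i)) = (\<Sum>a<m. cnj (u l a) * (\<Sum>i<?n. w 0 i * cnj (w (Suc a) i)))"
        unfolding u'_def by (simp only: nat.case cnj_sum complex_cnj_mult sum_distrib_left mult_ac)
          (rule sum.swap)
      also have "\<dots> = 0" by (intro sum.neutral ballI) (use ip in auto)
      finally show ?thesis .
    qed
    have diag: "(\<Sum>i<?n. u' (Suc k) i * cnj (u' (Suc l) i)) = (if k = l then 1 else 0)" if "k < m" "l < m" for k l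
    proof -
      have "(\<Sum>i<?n. u' (Suc k) i * cnj (u' (Suc l) i))
          = (\<Sum>i<?n. \<Sum>a<m. \<Sum>b<m. u k a * cnj (u l b) * (w (Suc a) i * cnj (w (Suc b) i)))"
        unfolding u'_def by (simp only: nat.case cnj_sum complex_cnj_mult sum_product mult_ac)
      also have "\<dots> = (\<Sum>a<m. \<Sum>b<m. \<Sum>i<?n. u k a * cnj (u l b) * (w (Suc a) i * cnj (w (Suc b) i)))"
        by (rule sum_rotate)
      also have "\<dots> = (\<Sum>a<m. \<Sum>b<m. if b = a then u k a * cnj (u l b) else 0)"
        by (intro sum.cong refl) (use ip in \<open>auto simp flip: sum_distrib_left\<close>)
      also have "\<dots> = (\<Sum>a<m. u k a * cnj (u l a))" by (intro sum.cong refl) auto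
      finally show ?thesis using orthonormalD[OF u] that by simp
    qed
    have cross': "(\<Sum>i<?n. u' (Suc k) i * cnj (w 0 i)) = 0" if "k < m" for k
      using arg_cong[OF cross[OF that], of cnj] by (simp add: mult.commute)
    have u'0: "u' 0 = w 0" unfolding u'_def by simp
    show ?thesis
      using kl cross cross' diag ip[of 0 0] by (cases k; cases l) (simp_all only: u'0, auto)
  qed
  then have "orthonormal {..<?n} {..<?n} u'" unfolding orthonormal_def by auto
  moreover have "A $$ (i, j) = (\<Sum>k<?n. of_real (p' k) * u' k i * cnj (u' k j))" if ij: "i < ?n" "j < ?n" for i j
  proof -
    have "A $$ (i, j) = (\<Sum>a<?n. \<Sum>b<?n. w a i * B a b * cnj (w b j))" by (rule AB[OF ij])
    also have "\<dots> = w 0 i * B 0 0 * cnj (w 0 j) + (\<Sum>a<m. \<Sum>b<m. w (Suc a) i * B (Suc a) (Suc b) * cnj (w (Suc b) j))"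
      using B0 B0' by (simp add: sum.lessThan_Suc_shift del: sum.lessThan_Suc)
    also have "(\<Sum>a<m. \<Sum>b<m. w (Suc a) i * B (Suc a) (Suc b) * cnj (w (Suc b) j))
       = (\<Sum>a<m. \<Sum>b<m. \<Sum>k<m. of_real (p k) * (u k a * w (Suc a) i) * (cnj (u k b) * cnj (w (Suc b) j)))"
    proof (intro sum.cong refl)
      fix a b assume "a \<in> {..<m}" "b \<in> {..<m}"
      then have "B (Suc a) (Suc b) = (\<Sum>k<m. of_real (p k) * u k a * cnj (u k b))"
        using C[of a b] by (simp add: C_def)
      then show "w (Suc a) i * B (Suc a) (Suc b) * cnj (w (Suc b) j)
        = (\<Sum>k<m. of_real (p k) * (u k a * w (Suc a) i) * (cnj (u k b) * cnj (w (Suc b) j)))"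
        by (simp only: sum_distrib_left sum_distrib_right mult_ac)
    qed
    also have "\<dots> = (\<Sum>k<m. \<Sum>a<m. \<Sum>b<m. of_real (p k) * (u k a * w (Suc a) i) * (cnj (u k b) * cnj (w (Suc b) j)))"
      by (rule sum_rotate[symmetric])
    also have "\<dots> = (\<Sum>k<m. of_real (p' (Suc k)) * u' (Suc k) i * cnj (u' (Suc k) j))"
      unfolding p'_def u'_def
      by (simp only: nat.case cnj_sum complex_cnj_mult sum_distrib_left sum_distrib_right mult_ac)
    also have "w 0 i * B 0 0 * cnj (w 0 j) = of_real (p' 0) * u' 0 i * cnj (u' 0 j)"
      unfolding p'_def u'_def using B0[of 0] by (simp add: mult_ac flip: e_real)
    also have "of_real (p' 0) * u' 0 i * cnj (u' 0 j) + (\<Sum>k<m. of_real (p' (Suc k)) * u' (Suc k) i * cnj (u' (Suc k) j))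
       = (\<Sum>k<?n. of_real (p' k) * u' k i * cnj (u' k j))"
      by (simp add: sum.lessThan_Suc_shift del: sum.lessThan_Suc)
    finally show ?thesis .
  qed
  ultimately have "spectral ?n A p' u'" using A unfolding spectral_def by auto
  then show ?case by blast
qed

section \<open>The von Neumann entropy read off from a spectral decomposition\<close>

lemma proots_prod_linear: "proots (\<Prod>a\<leftarrow>as. [:- a, 1:]) = mset as"
  for as :: "'a :: idom list"
proof (induction as)
  case (Cons a as)
  have "(\<Prod>a\<leftarrow>as. [:- a, 1:]) \<noteq> 0" by (auto simp: prod_list_zero_iff)
  then show ?case using Cons by (simp add: proots_mult del: mult_pCons_left)
qed simp

text \<open>\<open>eigvals\<close> picks some factorisation of the characteristic polynomial into
  linear factors. Such a factorisation is unique up to order and the entropy ignores order, so any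
  diagonal matrix similar to A gives the same value.\<close>

lemma vn_entropy_spectral:
  assumes "spectral n A p u"
  shows "vn_entropy A = (\<Sum>k<n. eta (p k))"
proof -
  have A: "A \<in> carrier_mat n n" and u: "orthonormal {..<n} {..<n} u"
    and Au: "\<And>i j. i < n \<Longrightarrow> j < n \<Longrightarrow> A $$ (i, j) = (\<Sum>k<n. of_real (p k) * u k i * cnj (u k j))"
    using assms unfolding spectral_def by auto
  define U where "U = mat n n (\<lambda>(i, k). u k i)"
  define V where "V = mat n n (\<lambda>(k, i). cnj (u k i))"
  define D where "D = mat n n (\<lambda>(k, l). if k = l then complex_of_real (p k) else 0)"
  have carr: "U \<in> carrier_mat n n" "V \<in> carrier_mat n n" "D \<in> carrier_mat n n"
    by (auto simp: U_def V_def D_def)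
  have UV: "U * V = 1\<^sub>m n"
    by (rule eq_matI) (use orthonormal_complete[OF u] in
        \<open>auto simp: U_def V_def scalar_prod_def atLeast0LessThan\<close>)
  have VU: "V * U = 1\<^sub>m n" by (rule mat_mult_left_right_inverse[OF carr(1,2) UV])
  have "A = U * D * V"
  proof (rule eq_matI)
    fix i j assume ij: "i < dim_row (U * D * V)" "j < dim_col (U * D * V)"
    then have ij: "i < n" "j < n" using carr by auto
    have "(U * D) $$ (i, k) = u k i * of_real (p k)" if "k < n" for k
      using ij that by (simp add: U_def D_def scalar_prod_def atLeast0LessThan if_distrib[of "(*) _"] cong: if_cong)
    then have row: "row (U * D) i = vec n (\<lambda>k. u k i * of_real (p k))"
      using ij carr by (intro eq_vecI) auto
    have "(U * D * V) $$ (i, j) = row (U * D) i \<bullet> col V j"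
      using ij carr by (intro index_mult_mat) auto
    then have "(U * D * V) $$ (i, j) = (\<Sum>k<n. u k i * of_real (p k) * cnj (u k j))"
      unfolding row using ij by (simp add: V_def scalar_prod_def atLeast0LessThan)
    then show "A $$ (i, j) = (U * D * V) $$ (i, j)" using Au[OF ij] by (simp add: mult_ac)
  qed (use A carr in auto)
  then have "similar_mat A D"
    using A carr UV VU by (intro similar_matI[of A D U V n]) auto
  then have "char_poly A = char_poly D" by (rule char_poly_similar)
  also have "\<dots> = (\<Prod>a\<leftarrow>diag_mat D. [:- a, 1:])"
    by (rule char_poly_upper_triangular[OF carr(3)]) (auto simp: D_def)
  finally have cp: "char_poly A = (\<Prod>a\<leftarrow>diag_mat D. [:- a, 1:])" .
  have dD: "diag_mat D = map (\<lambda>k. complex_of_real (p k)) [0..<n]"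
    unfolding diag_mat_def using carr by (auto simp: D_def)
  \<comment> \<open>The diagonal of \<open>D\<close> witnesses that the choice in
    \<open>eigvals\<close> is meaningful.\<close>
  have "length (eigvals A) = dim_row A \<and> char_poly A = (\<Prod>a\<leftarrow>eigvals A. [:- a, 1:])"
    unfolding eigvals_def by (rule someI[of _ "diag_mat D"]) (use A cp dD in simp)
  then have "mset (eigvals A) = mset (diag_mat D)"
    using cp proots_prod_linear by metis
  then have "(\<Sum>l\<in>#mset (eigvals A). eta (Re l)) = (\<Sum>l\<in>#mset (diag_mat D). eta (Re l))" by simp
  then have "vn_entropy A = (\<Sum>l\<leftarrow>diag_mat D. eta (Re l))"
    unfolding vn_entropy_def by (simp add: sum_mset_sum_list flip: mset_map)
  then show ?thesis by (simp add: dD comp_def sum_list_sum_nth atLeast0LessThan)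
qed

section \<open>Entropy inequalities for eigenvalues\<close>

lemma cmod_square: "(complex_of_real (cmod z))\<^sup>2 = z * cnj z"
  using complex_norm_square[of z] by simp

section \<open>Shannon entropy: cross entropy, Gibbs' inequality, subadditivity\<close>

lemma eta_eq: "x \<ge> 0 \<Longrightarrow> eta x = - x * ln x"
  by (auto simp: eta_def)

text \<open>Apply ln t \<le> t - 1 at t = q_x / p_i, weight by p_i D_ix and sum. \<open>D\<close>
  acts as a transition matrix: row sums 1 where p_i is nonzero preserve the weight of
  \<open>p\<close>, and column sums at most 1 bound the total of D_ix q_x by that of
  \<open>q\<close>. The identity matrix gives Gibbs' inequality, squared overlaps give
  \<open>entropy_le_ensemble\<close>.\<close>

lemma entropy_le_cross_entropy:
  fixes p :: "'i \<Rightarrow> real" and D :: "'i \<Rightarrow> 'x \<Rightarrow> real" and q :: "'x \<Rightarrow> real"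
  assumes fin: "finite I" "finite X"
    and p: "\<And>i. i \<in> I \<Longrightarrow> p i \<ge> 0" and q: "\<And>x. x \<in> X \<Longrightarrow> q x \<ge> 0"
    and D: "\<And>i x. i \<in> I \<Longrightarrow> x \<in> X \<Longrightarrow> D i x \<ge> 0"
    and Dx: "\<And>i. i \<in> I \<Longrightarrow> p i \<noteq> 0 \<Longrightarrow> (\<Sum>x\<in>X. D i x) = 1"
    and Di: "\<And>x. x \<in> X \<Longrightarrow> (\<Sum>i\<in>I. D i x) \<le> 1"
    and qp: "sum q X \<le> sum p I"
    and supp: "\<And>i x. i \<in> I \<Longrightarrow> x \<in> X \<Longrightarrow> q x = 0 \<Longrightarrow> p i * D i x = 0"
  shows "(\<Sum>i\<in>I. eta (p i)) \<le> - (\<Sum>x\<in>X. (\<Sum>i\<in>I. p i * D i x) * ln (q x))"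
proof -
  have pD: "(\<Sum>x\<in>X. p i * D i x) = p i" if "i \<in> I" for i
    using Dx[OF that] by (cases "p i = 0") (auto simp flip: sum_distrib_left)
  have term_le: "p i * D i x * ln (q x) - p i * D i x * ln (p i) \<le> D i x * q x - p i * D i x"
    if i: "i \<in> I" and x: "x \<in> X" for i x
  proof (cases "p i * D i x = 0")
    \<comment> \<open>With zero weight the left side is 0, whatever value \<open>ln\<close> takes at
      0, and the right side reduces to D_ix q_x.\<close>
    case True
    then show ?thesis using D[OF i x] q[OF x] by auto
  next
    case False
    then have pos: "p i > 0" "D i x > 0" "q x > 0"
      using p[OF i] D[OF i x] q[OF x] supp[OF i x] by (auto simp: less_le)
    have "ln (q x) - ln (p i) \<le> q x / p i - 1"
      using ln_le_minus_one[of "q x / p i"] pos by (simp add: ln_div)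
    have "(p i * D i x) * (ln (q x) - ln (p i)) \<le> (p i * D i x) * (q x / p i - 1)"
      using pos \<open>ln (q x) - ln (p i) \<le> q x / p i - 1\<close> by (intro mult_left_mono) auto
    also have "\<dots> = D i x * q x - p i * D i x" using pos by (simp add: field_simps)
    finally show ?thesis by (simp add: right_diff_distrib)
  qed
  have "(\<Sum>i\<in>I. eta (p i)) + (\<Sum>x\<in>X. (\<Sum>i\<in>I. p i * D i x) * ln (q x))
      = (\<Sum>i\<in>I. \<Sum>x\<in>X. p i * D i x * ln (q x) - p i * D i x * ln (p i))"
  proof -
    have "(\<Sum>x\<in>X. (\<Sum>i\<in>I. p i * D i x) * ln (q x)) = (\<Sum>i\<in>I. \<Sum>x\<in>X. p i * D i x * ln (q x))"
      by (simp only: sum_distrib_right) (rule sum.swap)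
    moreover have "eta (p i) = - (\<Sum>x\<in>X. p i * D i x * ln (p i))" if "i \<in> I" for i
      using pD[OF that] p[OF that] by (simp add: eta_eq flip: sum_distrib_right)
    ultimately show ?thesis by (simp add: sum_subtractf sum_negf)
  qed
  also have "\<dots> \<le> (\<Sum>i\<in>I. \<Sum>x\<in>X. D i x * q x - p i * D i x)"
    by (intro sum_mono term_le)
  also have "\<dots> = (\<Sum>x\<in>X. (\<Sum>i\<in>I. D i x) * q x) - sum p I"
    by (simp add: sum_subtractf sum_distrib_right pD) (rule sum.swap)
  also have "\<dots> \<le> sum q X - sum p I"
    using mult_right_mono[OF Di q] by (simp add: sum_mono)
  also have "\<dots> \<le> 0" using qp by simp
  finally show ?thesis by simp
qed

lemma gibbs:
  fixes p q :: "'i \<Rightarrow> real"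
  assumes "finite I" "\<And>i. i \<in> I \<Longrightarrow> p i \<ge> 0" "\<And>i. i \<in> I \<Longrightarrow> q i \<ge> 0"
    "sum q I \<le> sum p I" "\<And>i. i \<in> I \<Longrightarrow> q i = 0 \<Longrightarrow> p i = 0"
  shows "(\<Sum>i\<in>I. eta (p i)) \<le> - (\<Sum>i\<in>I. p i * ln (q i))"
proof -
  have "(\<Sum>i\<in>I. eta (p i)) \<le> - (\<Sum>x\<in>I. (\<Sum>i\<in>I. p i * (if i = x then 1 else 0)) * ln (q x))"
    by (rule entropy_le_cross_entropy) (use assms in auto)
  then show ?thesis using assms(1) by (simp add: if_distrib[of "(*) _"] cong: if_cong)
qed

text \<open>Gibbs' inequality against the uniform distribution.\<close>

lemma entropy_le_ln_card:
  assumes "finite I" "\<And>i. i \<in> I \<Longrightarrow> p i \<ge> 0" "sum p I = 1"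
  shows "(\<Sum>i\<in>I. eta (p i)) \<le> ln (real (card I))"
proof -
  have "card I > 0" using assms by (metis card_gt_0_iff sum.empty zero_neq_one)
  then have "(\<Sum>i\<in>I. eta (p i)) \<le> - (\<Sum>i\<in>I. p i * ln (1 / real (card I)))"
    using assms by (intro gibbs) auto
  then show ?thesis using assms(3) \<open>card I > 0\<close> by (simp add: ln_div sum_negf flip: sum_distrib_right)
qed

lemma entropy_nonneg:
  assumes "finite I" "\<And>i. i \<in> I \<Longrightarrow> p i \<ge> 0" "sum p I = 1"
  shows "(\<Sum>i\<in>I. eta (p i)) \<ge> 0"
proof (rule sum_nonneg)
  fix i assume i: "i \<in> I"
  have "p i \<le> 1" using member_le_sum[OF i, of p] assms by simp
  then show "eta (p i) \<ge> 0" by (auto simp: eta_def mult_nonneg_nonpos)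
qed

text \<open>Gibbs' inequality against the product of the two marginals, whose logarithm splits into
  a sum.\<close>

lemma entropy_subadditive:
  fixes P :: "'j \<times> 'k \<Rightarrow> real"
  assumes fin: "finite J" "finite K" and P: "\<And>x. x \<in> J \<times> K \<Longrightarrow> P x \<ge> 0" and one: "sum P (J \<times> K) = 1"
  shows "(\<Sum>x\<in>J \<times> K. eta (P x))
      \<le> (\<Sum>j\<in>J. eta (\<Sum>k\<in>K. P (j, k))) + (\<Sum>k\<in>K. eta (\<Sum>j\<in>J. P (j, k)))"
proof -
  define f where "f j = (\<Sum>k\<in>K. P (j, k))" for j
  define g where "g k = (\<Sum>j\<in>J. P (j, k))" for k
  have f0: "f j \<ge> 0" if "j \<in> J" for j unfolding f_def using P that by (auto intro: sum_nonneg)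
  have g0: "g k \<ge> 0" if "k \<in> K" for k unfolding g_def using P that by (auto intro: sum_nonneg)
  have fP: "P (j, k) = 0" if "j \<in> J" "k \<in> K" "f j = 0" for j k
    using that sum_nonneg_eq_0_iff[of K "\<lambda>k. P (j, k)"] fin P unfolding f_def by auto
  have gP: "P (j, k) = 0" if "j \<in> J" "k \<in> K" "g k = 0" for j k
    using that sum_nonneg_eq_0_iff[of J "\<lambda>j. P (j, k)"] fin P unfolding g_def by auto
  have f1: "sum f J = 1" unfolding f_def using one by (simp add: sum.cartesian_product)
  have g1: "sum g K = 1" unfolding g_def using one by (subst sum.swap) (simp add: sum.cartesian_product)
  have "(\<Sum>x\<in>J \<times> K. eta (P x)) \<le> - (\<Sum>x\<in>J \<times> K. P x * ln (case x of (j, k) \<Rightarrow> f j * g k))"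
  proof (rule gibbs)
    show "(\<Sum>x\<in>J \<times> K. case x of (j, k) \<Rightarrow> f j * g k) \<le> sum P (J \<times> K)"
      using f1 g1 one by (simp add: sum_product[symmetric] flip: sum.cartesian_product)
  qed (use fin P f0 g0 fP gP in auto)
  also have "(\<Sum>x\<in>J \<times> K. P x * ln (case x of (j, k) \<Rightarrow> f j * g k))
      = (\<Sum>j\<in>J. \<Sum>k\<in>K. P (j, k) * ln (f j) + P (j, k) * ln (g k))"
    unfolding sum.cartesian_product
  proof (intro sum.cong refl, clarsimp)
    fix j k assume jk: "j \<in> J" "k \<in> K"
    \<comment> \<open>\<open>ln\<close> of a product splits only for positive factors; if a marginal
      vanishes, so does \<open>P (j, k)\<close>, and both sides are 0.\<close>
    show "P (j, k) * ln (f j * g k) = P (j, k) * ln (f j) + P (j, k) * ln (g k)"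
      using fP[OF jk] gP[OF jk] f0[OF jk(1)] g0[OF jk(2)]
      by (cases "f j = 0"; cases "g k = 0") (auto simp: ln_mult algebra_simps)
  qed
  also have "\<dots> = (\<Sum>j\<in>J. f j * ln (f j)) + (\<Sum>k\<in>K. g k * ln (g k))"
  proof -
    have "(\<Sum>j\<in>J. \<Sum>k\<in>K. P (j, k) * ln (g k)) = (\<Sum>k\<in>K. g k * ln (g k))"
      unfolding g_def by (subst sum.swap) (simp add: sum_distrib_right)
    moreover have "(\<Sum>j\<in>J. \<Sum>k\<in>K. P (j, k) * ln (f j)) = (\<Sum>j\<in>J. f j * ln (f j))"
      unfolding f_def by (simp add: sum_distrib_right)
    ultimately show ?thesis by (simp add: sum.distrib)
  qed
  also have "- \<dots> = (\<Sum>j\<in>J. eta (f j)) + (\<Sum>k\<in>K. eta (g k))"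
    using f0 g0 by (simp add: eta_eq sum_negf)
  finally show ?thesis unfolding f_def g_def .
qed

section \<open>Orthonormal systems and mixtures of pure states\<close>

lemma bessel:
  assumes fin: "finite I" "finite X" and V: "orthonormal I X V" and x: "x \<in> X"
  shows "(\<Sum>i\<in>I. (cmod (V i x))\<^sup>2) \<le> 1"
proof -
  define s where "s = (\<Sum>i\<in>I. (cmod (V i x))\<^sup>2)"
  \<comment> \<open>The projection of the standard basis vector at \<open>x\<close> onto the span of
    the family. Both its coordinate at \<open>x\<close> and its squared norm equal \<open>s\<close>,
    and a single squared coordinate is at most the squared norm, so s^2 \<le> s.\<close>
  define f where "f y = (\<Sum>i\<in>I. cnj (V i x) * V i y)" for y
  have s0: "s \<ge> 0" unfolding s_def by (intro sum_nonneg) simp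
  have fx: "f x = complex_of_real s"
    unfolding f_def s_def by (simp add: cmod_square mult.commute)
  have "complex_of_real (\<Sum>y\<in>X. (cmod (f y))\<^sup>2) = (\<Sum>y\<in>X. f y * cnj (f y))"
    by (simp add: cmod_square)
  also have "\<dots> = (\<Sum>y\<in>X. \<Sum>i\<in>I. \<Sum>l\<in>I. cnj (V i x) * V l x * (V i y * cnj (V l y)))"
    unfolding f_def by (simp add: sum_product mult_ac)
  also have "\<dots> = (\<Sum>i\<in>I. \<Sum>l\<in>I. cnj (V i x) * V l x * (\<Sum>y\<in>X. V i y * cnj (V l y)))"
    by (subst sum_rotate) (simp add: sum_distrib_left)
  also have "\<dots> = (\<Sum>i\<in>I. \<Sum>l\<in>I. if l = i then cnj (V i x) * V l x else 0)"
    by (intro sum.cong refl) (auto simp: orthonormalD[OF V])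
  also have "\<dots> = f x"
    unfolding f_def using fin by (intro sum.cong refl) simp
  finally have "(\<Sum>y\<in>X. (cmod (f y))\<^sup>2) = s" unfolding fx by (simp only: of_real_eq_iff)
  moreover have "(cmod (f x))\<^sup>2 \<le> (\<Sum>y\<in>X. (cmod (f y))\<^sup>2)"
    using x fin by (intro member_le_sum) auto
  ultimately have "s * s \<le> s * 1" unfolding fx using s0 by (simp add: power2_eq_square)
  then have "s \<le> 1" using s0 by (cases "s = 0") auto
  then show ?thesis unfolding s_def .
qed

text \<open>Labels and coordinates may have different types, so completeness is part of the
  definition instead of following from a count of dimensions.\<close>

definition onb :: "'k set \<Rightarrow> 'i set \<Rightarrow> ('k \<Rightarrow> 'i \<Rightarrow> complex) \<Rightarrow> bool" where
  "onb K I u \<longleftrightarrow> orthonormal K I u \<and>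
     (\<forall>i\<in>I. \<forall>j\<in>I. (\<Sum>k\<in>K. u k i * cnj (u k j)) = (if i = j then 1 else 0))"

lemma onbD:
  assumes "onb K I u"
  shows "k \<in> K \<Longrightarrow> l \<in> K \<Longrightarrow> (\<Sum>i\<in>I. u k i * cnj (u l i)) = (if k = l then 1 else 0)"
    and "i \<in> I \<Longrightarrow> j \<in> I \<Longrightarrow> (\<Sum>k\<in>K. u k i * cnj (u k j)) = (if i = j then 1 else 0)"
  using assms unfolding onb_def orthonormal_def by blast+

lemma parseval:
  assumes "onb I A u" "finite A"
  shows "(\<Sum>i\<in>I. (\<Sum>a\<in>A. cnj (u i a) * f a) * cnj (\<Sum>a\<in>A. cnj (u i a) * g a)) = (\<Sum>a\<in>A. f a * cnj (g a))"
proof -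
  have "(\<Sum>i\<in>I. (\<Sum>a\<in>A. cnj (u i a) * f a) * cnj (\<Sum>a\<in>A. cnj (u i a) * g a))
      = (\<Sum>i\<in>I. \<Sum>a\<in>A. \<Sum>b\<in>A. f a * cnj (g b) * (u i b * cnj (u i a)))"
    by (simp add: sum_product mult_ac)
  also have "\<dots> = (\<Sum>a\<in>A. \<Sum>b\<in>A. f a * cnj (g b) * (\<Sum>i\<in>I. u i b * cnj (u i a)))"
    by (subst sum_rotate) (simp add: sum_distrib_left)
  also have "\<dots> = (\<Sum>a\<in>A. \<Sum>b\<in>A. if b = a then f a * cnj (g b) else 0)"
    by (intro sum.cong refl) (auto simp: onbD(2)[OF assms(1)])
  also have "\<dots> = (\<Sum>a\<in>A. f a * cnj (g a))" using assms(2) by simp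
  finally show ?thesis .
qed

text \<open>The left side is the matrix element <u_i, R u_l>, and R is diagonal in its own
  eigenbasis.\<close>

lemma eigenbasis_coeff:
  assumes u: "onb I A u" and fin: "finite I" and i: "i \<in> I" "l \<in> I"
    and R: "\<And>a b. a \<in> A \<Longrightarrow> b \<in> A \<Longrightarrow> R a b = (\<Sum>k\<in>I. of_real (p k) * u k a * cnj (u k b))"
  shows "(\<Sum>a\<in>A. \<Sum>b\<in>A. cnj (u i a) * u l b * R a b) = (if i = l then of_real (p i) else 0)"
proof -
  have "(\<Sum>a\<in>A. \<Sum>b\<in>A. cnj (u i a) * u l b * R a b)
      = (\<Sum>a\<in>A. \<Sum>b\<in>A. \<Sum>k\<in>I. of_real (p k) * ((u k a * cnj (u i a)) * (u l b * cnj (u k b))))"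
    by (intro sum.cong refl) (simp add: R sum_distrib_left mult_ac)
  also have "\<dots> = (\<Sum>k\<in>I. of_real (p k) * ((\<Sum>a\<in>A. u k a * cnj (u i a)) * (\<Sum>b\<in>A. u l b * cnj (u k b))))"
    by (subst sum_rotate[symmetric]) (simp only: sum_product, simp only: sum_distrib_left)
  also have "\<dots> = (\<Sum>k\<in>I. if k = i then (if k = l then of_real (p k) else 0) else 0)"
    by (intro sum.cong refl) (use i in \<open>auto simp: onbD(1)[OF u]\<close>)
  also have "\<dots> = (if i = l then of_real (p i) else 0)" using fin i by simp
  finally show ?thesis .
qed

text \<open>
  The numbers $\langle u_i, \phi_x\rangle / \sqrt{p_i}$ form a matrix with orthonormal rows. By Bessel its
  squared moduli are doubly substochastic, and they carry $p$ to the weights $\|\phi_x\|^2$.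
\<close>

lemma entropy_le_ensemble:
  fixes u :: "'i \<Rightarrow> 'a \<Rightarrow> complex" and \<phi> :: "'x \<Rightarrow> 'a \<Rightarrow> complex" and p :: "'i \<Rightarrow> real"
  assumes fin: "finite A" "finite I" "finite X" and u: "onb I A u"
    and p: "\<And>i. i \<in> I \<Longrightarrow> p i \<ge> 0"
    and mix: "\<And>a b. a \<in> A \<Longrightarrow> b \<in> A \<Longrightarrow>
      (\<Sum>x\<in>X. \<phi> x a * cnj (\<phi> x b)) = (\<Sum>i\<in>I. of_real (p i) * u i a * cnj (u i b))"
  shows "(\<Sum>i\<in>I. eta (p i)) \<le> (\<Sum>x\<in>X. eta (\<Sum>a\<in>A. (cmod (\<phi> x a))\<^sup>2))"
proof -
  define c where "c i x = (\<Sum>a\<in>A. cnj (u i a) * \<phi> x a)" for i x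
  define P where "P x = (\<Sum>a\<in>A. (cmod (\<phi> x a))\<^sup>2)" for x
  define D where "D i x = (cmod (c i x))\<^sup>2 / p i" for i x
  \<comment> \<open>The overlaps \<open>c\<close> form a matrix whose Gram matrix is the mixture
    written in its eigenbasis: rows are orthogonal, with squared lengths \<open>p i\<close>.\<close>
  have G: "(\<Sum>x\<in>X. c i x * cnj (c l x)) = (if i = l then of_real (p i) else 0)" if "i \<in> I" "l \<in> I" for i l
  proof -
    have "(\<Sum>x\<in>X. c i x * cnj (c l x))
        = (\<Sum>x\<in>X. \<Sum>a\<in>A. \<Sum>b\<in>A. cnj (u i a) * u l b * (\<phi> x a * cnj (\<phi> x b)))"
      unfolding c_def by (simp add: sum_product mult_ac)
    also have "\<dots> = (\<Sum>a\<in>A. \<Sum>b\<in>A. cnj (u i a) * u l b * (\<Sum>x\<in>X. \<phi> x a * cnj (\<phi> x b)))"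
      by (subst sum_rotate) (simp add: sum_distrib_left)
    also have "\<dots> = (if i = l then of_real (p i) else 0)"
      by (rule eigenbasis_coeff[OF u fin(2) that mix])
    finally show ?thesis .
  qed
  have Gp: "(\<Sum>x\<in>X. (cmod (c i x))\<^sup>2) = p i" if "i \<in> I" for i
  proof -
    have "complex_of_real (\<Sum>x\<in>X. (cmod (c i x))\<^sup>2) = of_real (p i)"
      using G[OF that that] by (simp add: cmod_square)
    then show ?thesis by (simp only: of_real_eq_iff)
  qed
  have c0: "c i x = 0" if "i \<in> I" "x \<in> X" "p i = 0" for i x
    using Gp[OF that(1)] that sum_nonneg_eq_0_iff[of X "\<lambda>x. (cmod (c i x))\<^sup>2"] fin by auto
  \<comment> \<open>Parseval in the basis \<open>u\<close>: the squared overlaps of \<phi>_x add up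
    to its weight.\<close>
  have cP: "(\<Sum>i\<in>I. (cmod (c i x))\<^sup>2) = P x" for x
  proof -
    have "complex_of_real (\<Sum>i\<in>I. (cmod (c i x))\<^sup>2) = complex_of_real (P x)"
      using parseval[OF u fin(1), of "\<phi> x" "\<phi> x"]
      unfolding c_def P_def by (simp add: cmod_square)
    then show ?thesis by (simp only: of_real_eq_iff)
  qed
  have pD: "p i * D i x = (cmod (c i x))\<^sup>2" if "i \<in> I" "x \<in> X" for i x
    using c0[OF that] unfolding D_def by auto
  have "(\<Sum>i\<in>I. eta (p i)) \<le> - (\<Sum>x\<in>X. (\<Sum>i\<in>I. p i * D i x) * ln (P x))"
  proof (rule entropy_le_cross_entropy)
    show "(\<Sum>x\<in>X. D i x) = 1" if "i \<in> I" "p i \<noteq> 0" for i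
      using Gp[OF that(1)] that(2) unfolding D_def by (simp flip: sum_divide_distrib)
    show "(\<Sum>i\<in>I. D i x) \<le> 1" if x: "x \<in> X" for x
    proof -
      \<comment> \<open>Rows can be normalised only where \<open>p i\<close> is nonzero. The other
        indices contribute nothing to the column sum, since division by zero makes
        \<open>D i x\<close> equal to 0.\<close>
      define I' where "I' = {i \<in> I. p i \<noteq> 0}"
      define V where "V i x = c i x / complex_of_real (sqrt (p i))" for i x
      have "orthonormal I' X V"
        unfolding orthonormal_def
      proof (intro ballI)
        fix i l assume il: "i \<in> I'" "l \<in> I'"
        have "(\<Sum>x\<in>X. V i x * cnj (V l x))
          = (\<Sum>x\<in>X. c i x * cnj (c l x)) / (complex_of_real (sqrt (p i)) * complex_of_real (sqrt (p l)))"
          unfolding V_def by (simp add: sum_divide_distrib)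
        also have "\<dots> = (if i = l then 1 else 0)"
          using G[of i l] il p[of i] p[of l] unfolding I'_def by (auto simp flip: of_real_mult)
        finally show "(\<Sum>x\<in>X. V i x * cnj (V l x)) = (if i = l then 1 else 0)" .
      qed
      then have "(\<Sum>i\<in>I'. (cmod (V i x))\<^sup>2) \<le> 1"
        using fin x by (intro bessel) (auto simp: I'_def)
      moreover have "(\<Sum>i\<in>I'. (cmod (V i x))\<^sup>2) = (\<Sum>i\<in>I'. D i x)"
        using p unfolding V_def D_def I'_def
        by (intro sum.cong refl) (auto simp: norm_divide power_divide)
      moreover have "(\<Sum>i\<in>I'. D i x) = (\<Sum>i\<in>I. D i x)"
        using fin unfolding I'_def D_def by (intro sum.mono_neutral_left) auto
      ultimately show ?thesis by simp
    qed
    have "sum P X = (\<Sum>i\<in>I. \<Sum>x\<in>X. (cmod (c i x))\<^sup>2)"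
      by (subst sum.swap) (simp add: cP)
    then show "sum P X \<le> sum p I" using Gp by simp
    show "p i * D i x = 0" if "i \<in> I" "x \<in> X" "P x = 0" for i x
      using cP[of x] that sum_nonneg_eq_0_iff[of I "\<lambda>i. (cmod (c i x))\<^sup>2"] fin pD by auto
  qed (use fin p in \<open>auto simp: D_def P_def sum_nonneg\<close>)
  also have "\<dots> = (\<Sum>x\<in>X. eta (P x))"
  proof -
    have "(\<Sum>i\<in>I. p i * D i x) = P x" if "x \<in> X" for x
      using cP[of x] pD that by simp
    moreover have "P x \<ge> 0" for x unfolding P_def by (simp add: sum_nonneg)
    ultimately show ?thesis by (simp add: eta_eq sum_negf)
  qed
  finally show ?thesis unfolding P_def .
qed

text \<open>The pure states are the vectors \<open>\<phi> (j, k)\<close>, the component of \<psi>_k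
  along w_j scaled by the root of p_k. Their squared lengths \<open>P\<close> sum over j to p_k by
  Parseval, and over k to the diagonal element of rho_B at w_j, which is \<beta>_j.\<close>

lemma araki_lieb_eigenvalues:
  fixes \<psi> :: "'k \<Rightarrow> 'a \<Rightarrow> 'b \<Rightarrow> complex"
  assumes fin: "finite K" "finite A" "finite B" "finite I" "finite J"
    and norm: "\<And>k. k \<in> K \<Longrightarrow> (\<Sum>a\<in>A. \<Sum>b\<in>B. \<psi> k a b * cnj (\<psi> k a b)) = 1"
    and p: "\<And>k. k \<in> K \<Longrightarrow> p k \<ge> 0" and p1: "sum p K = 1"
    and u: "onb I A u" and \<alpha>: "\<And>i. i \<in> I \<Longrightarrow> \<alpha> i \<ge> 0"
    and w: "onb J B w"
    and rA: "\<And>a a'. a \<in> A \<Longrightarrow> a' \<in> A \<Longrightarrow>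
       (\<Sum>k\<in>K. of_real (p k) * (\<Sum>b\<in>B. \<psi> k a b * cnj (\<psi> k a' b))) = (\<Sum>i\<in>I. of_real (\<alpha> i) * u i a * cnj (u i a'))"
    and rB: "\<And>b b'. b \<in> B \<Longrightarrow> b' \<in> B \<Longrightarrow>
       (\<Sum>k\<in>K. of_real (p k) * (\<Sum>a\<in>A. \<psi> k a b * cnj (\<psi> k a b'))) = (\<Sum>j\<in>J. of_real (\<beta> j) * w j b * cnj (w j b'))"
  shows "(\<Sum>i\<in>I. eta (\<alpha> i)) \<le> (\<Sum>j\<in>J. eta (\<beta> j)) + (\<Sum>k\<in>K. eta (p k))"
proof -
  \<comment> \<open>The partial inner product of w_j with \<psi>_k over the second subsystem, a
    vector of the first.\<close>
  define c where "c j k a = (\<Sum>b\<in>B. cnj (w j b) * \<psi> k a b)" for j k a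
  define \<phi> where "\<phi> = (\<lambda>(j, k) a. complex_of_real (sqrt (p k)) * c j k a)"
  define P where "P x = (\<Sum>a\<in>A. (cmod (\<phi> x a))\<^sup>2)" for x
  have pp: "complex_of_real (sqrt (p k)) * complex_of_real (sqrt (p k)) = of_real (p k)" if "k \<in> K" for k
    using p[OF that] by (simp flip: of_real_mult)
  have cc: "(\<Sum>j\<in>J. c j k a * cnj (c j k a')) = (\<Sum>b\<in>B. \<psi> k a b * cnj (\<psi> k a' b))" for k a a'
    unfolding c_def by (rule parseval[OF w fin(3)])
  have ff: "\<phi> (j, k) a * cnj (\<phi> (j, k) a') = of_real (p k) * (c j k a * cnj (c j k a'))" if "k \<in> K" for j k a a'
    unfolding \<phi>_def by (simp add: mult_ac flip: pp[OF that])
  have Pc: "complex_of_real (P (j, k)) = (\<Sum>a\<in>A. of_real (p k) * (c j k a * cnj (c j k a)))" if "k \<in> K" for j k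
    unfolding P_def by (simp add: cmod_square ff[OF that])
  have Pk: "(\<Sum>j\<in>J. P (j, k)) = p k" if k: "k \<in> K" for k
  proof -
    have "complex_of_real (\<Sum>j\<in>J. P (j, k)) = (\<Sum>a\<in>A. of_real (p k) * (\<Sum>j\<in>J. c j k a * cnj (c j k a)))"
      by (simp add: Pc[OF k] sum.swap[of _ A J] sum_distrib_left)
    also have "\<dots> = of_real (p k)"
      unfolding cc using norm[OF k] by (simp flip: sum_distrib_left)
    finally show ?thesis by (simp only: of_real_eq_iff)
  qed
  have Pj: "(\<Sum>k\<in>K. P (j, k)) = \<beta> j" if j: "j \<in> J" for j
  proof -
    have "complex_of_real (\<Sum>k\<in>K. P (j, k)) = (\<Sum>k\<in>K. of_real (p k) * (\<Sum>a\<in>A. c j k a * cnj (c j k a)))"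
      by (simp add: Pc sum_distrib_left)
    also have "\<dots> = (\<Sum>k\<in>K. \<Sum>a\<in>A. \<Sum>b\<in>B. \<Sum>b'\<in>B.
        cnj (w j b) * w j b' * (of_real (p k) * (\<psi> k a b * cnj (\<psi> k a b'))))"
      unfolding c_def by (simp add: sum_product sum_distrib_left mult_ac)
    also have "\<dots> = (\<Sum>b\<in>B. \<Sum>b'\<in>B. \<Sum>k\<in>K. \<Sum>a\<in>A.
        cnj (w j b) * w j b' * (of_real (p k) * (\<psi> k a b * cnj (\<psi> k a b'))))"
      by (rule sum_swap_pairs)
    also have "\<dots> = (\<Sum>b\<in>B. \<Sum>b'\<in>B. cnj (w j b) * w j b' *
        (\<Sum>k\<in>K. of_real (p k) * (\<Sum>a\<in>A. \<psi> k a b * cnj (\<psi> k a b'))))"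
      by (simp only: sum_distrib_left)
    also have "\<dots> = of_real (\<beta> j)"
      using eigenbasis_coeff[OF w fin(5) j j rB] by simp
    finally show ?thesis by (simp only: of_real_eq_iff)
  qed
  have "(\<Sum>i\<in>I. eta (\<alpha> i)) \<le> (\<Sum>x\<in>J \<times> K. eta (P x))"
    unfolding P_def
  proof (rule entropy_le_ensemble[OF fin(2) fin(4) _ u \<alpha>])
    fix a a' assume a: "a \<in> A" "a' \<in> A"
    have "(\<Sum>x\<in>J \<times> K. \<phi> x a * cnj (\<phi> x a')) = (\<Sum>j\<in>J. \<Sum>k\<in>K. of_real (p k) * (c j k a * cnj (c j k a')))"
      by (simp add: ff sum.cartesian_product case_prod_beta) (intro sum.cong refl, auto simp: ff)
    also have "\<dots> = (\<Sum>k\<in>K. of_real (p k) * (\<Sum>j\<in>J. c j k a * cnj (c j k a')))"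
      by (subst sum.swap) (simp add: sum_distrib_left)
    also have "\<dots> = (\<Sum>i\<in>I. of_real (\<alpha> i) * u i a * cnj (u i a'))"
      unfolding cc by (rule rA[OF a])
    finally show "(\<Sum>x\<in>J \<times> K. \<phi> x a * cnj (\<phi> x a')) = (\<Sum>i\<in>I. of_real (\<alpha> i) * u i a * cnj (u i a'))" .
  qed (use fin in auto)
  also have "\<dots> \<le> (\<Sum>j\<in>J. eta (\<Sum>k\<in>K. P (j, k))) + (\<Sum>k\<in>K. eta (\<Sum>j\<in>J. P (j, k)))"
  proof (rule entropy_subadditive)
    have "sum P (J \<times> K) = (\<Sum>k\<in>K. \<Sum>j\<in>J. P (j, k))"
      by (subst sum.swap) (simp add: sum.cartesian_product)
    then show "sum P (J \<times> K) = 1" using p1 by (simp add: Pk)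
  qed (use fin in \<open>auto simp: P_def sum_nonneg\<close>)
  also have "\<dots> = (\<Sum>j\<in>J. eta (\<beta> j)) + (\<Sum>k\<in>K. eta (p k))" by (simp add: Pk Pj)
  finally show ?thesis .
qed

section \<open>Density operators and the Araki--Lieb inequality\<close>

lemma spectral_onb: "spectral n A p u \<Longrightarrow> onb {..<n} {..<n} u"
  unfolding spectral_def onb_def using orthonormal_complete by blast

lemma spectralD:
  "spectral n A p u \<Longrightarrow> i < n \<Longrightarrow> j < n \<Longrightarrow> A $$ (i, j) = (\<Sum>k<n. of_real (p k) * u k i * cnj (u k j))"
  unfolding spectral_def by blast

lemma quadratic_form_eq:
  assumes "A \<in> carrier_mat n n" "v \<in> carrier_vec n"
  shows "conjugate v \<bullet> (A *\<^sub>v v) = (\<Sum>a<n. \<Sum>b<n. cnj (v $ a) * v $ b * A $$ (a, b))"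
  using assms by (simp add: scalar_prod_def atLeast0LessThan sum_distrib_left mult_ac)

text \<open>The eigenvalue p_k is the value of the quadratic form at the unit vector u_k, hence
  nonnegative; the eigenvalues sum to the trace.\<close>

lemma density_spectral:
  assumes "density_operator n A"
  obtains p u where "spectral n A p u" "\<And>k. k < n \<Longrightarrow> p k \<ge> 0" "sum p {..<n} = 1"
proof -
  have A: "A \<in> carrier_mat n n" and tr: "(\<Sum>i<n. A $$ (i, i)) = 1"
    and pos: "\<And>v. v \<in> carrier_vec n \<Longrightarrow> Re (conjugate v \<bullet> (A *\<^sub>v v)) \<ge> 0"
    using assms unfolding density_operator_def Let_def by blast+
  obtain p u where sp: "spectral n A p u"
    using spectral_ex[OF A] assms unfolding density_operator_def by blast
  note u = spectral_onb[OF sp]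
  have "p k \<ge> 0" if k: "k < n" for k
  proof -
    have "(\<Sum>a<n. \<Sum>b<n. cnj (u k a) * u k b * A $$ (a, b)) = of_real (p k)"
      using eigenbasis_coeff[OF u, of k k "\<lambda>a b. A $$ (a, b)" p] k spectralD[OF sp] by simp
    moreover have "conjugate (vec n (u k)) \<bullet> (A *\<^sub>v vec n (u k)) = (\<Sum>a<n. \<Sum>b<n. cnj (u k a) * u k b * A $$ (a, b))"
      using quadratic_form_eq[OF A, of "vec n (u k)"] by simp
    ultimately show ?thesis using pos[of "vec n (u k)"] by simp
  qed
  moreover have "sum p {..<n} = 1"
  proof -
    have "(\<Sum>i<n. A $$ (i, i)) = (\<Sum>i<n. \<Sum>k<n. of_real (p k) * u k i * cnj (u k i))"
      by (intro sum.cong refl spectralD[OF sp]) auto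
    also have "\<dots> = (\<Sum>k<n. of_real (p k) * (\<Sum>i<n. u k i * cnj (u k i)))"
      by (subst sum.swap) (simp only: sum_distrib_left mult.assoc)
    also have "\<dots> = (\<Sum>k<n. of_real (p k))"
      by (intro sum.cong refl) (simp add: onbD(1)[OF u])
    finally have "complex_of_real (sum p {..<n}) = complex_of_real 1" using tr by simp
    then show ?thesis by (simp only: of_real_eq_iff)
  qed
  ultimately show thesis using that sp by blast
qed

text \<open>The quadratic form at v is the sum of r_t |<v, g_t>|^2. The vectors \<open>g t\<close>
  need not be unit vectors, so the trace is a separate hypothesis; slices of eigenvectors have this
  shape.\<close>

lemma density_of_ensemble:
  assumes A: "A \<in> carrier_mat n n" and fin: "finite T"
    and r: "\<And>t. t \<in> T \<Longrightarrow> r t \<ge> 0"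
    and Ag: "\<And>a b. a < n \<Longrightarrow> b < n \<Longrightarrow> A $$ (a, b) = (\<Sum>t\<in>T. of_real (r t) * g t a * cnj (g t b))"
    and tr: "(\<Sum>i<n. A $$ (i, i)) = 1"
  shows "density_operator n A"
  unfolding density_operator_def
proof (intro conjI allI impI ballI)
  show "A $$ (i, j) = cnj (A $$ (j, i))" if "i < n" "j < n" for i j
    using that by (simp add: Ag mult_ac)
  show "let q = conjugate v \<bullet> (A *\<^sub>v v) in Im q = 0 \<and> 0 \<le> Re q" if v: "v \<in> carrier_vec n" for v
  proof -
    define z where "z t = (\<Sum>a<n. cnj (v $ a) * g t a)" for t
    have "conjugate v \<bullet> (A *\<^sub>v v)
        = (\<Sum>a<n. \<Sum>b<n. \<Sum>t\<in>T. of_real (r t) * ((cnj (v $ a) * g t a) * cnj (cnj (v $ b) * g t b)))"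
      unfolding quadratic_form_eq[OF A v] by (intro sum.cong refl) (simp add: Ag sum_distrib_left mult_ac)
    also have "\<dots> = (\<Sum>t\<in>T. of_real (r t) * (z t * cnj (z t)))"
      unfolding z_def cnj_sum sum_product
      by (subst sum_rotate[symmetric]) (simp only: sum_distrib_left)
    also have "\<dots> = complex_of_real (\<Sum>t\<in>T. r t * (cmod (z t))\<^sup>2)"
      by (simp add: cmod_square)
    finally show ?thesis using r by (simp add: Let_def sum_nonneg)
  qed
qed (use A tr in auto)

lemma vn_entropy_nonneg: "density_operator n A \<Longrightarrow> vn_entropy A \<ge> 0"
  by (elim density_spectral) (auto simp: vn_entropy_spectral intro!: entropy_nonneg)

lemma vn_entropy_le_ln_dim:
  assumes "density_operator n A" shows "vn_entropy A \<le> ln (real n)"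
proof -
  obtain p u where "spectral n A p u" "\<And>k. k < n \<Longrightarrow> p k \<ge> 0" "sum p {..<n} = 1"
    using density_spectral[OF assms] by blast
  then show ?thesis using entropy_le_ln_card[of "{..<n}" p] by (simp add: vn_entropy_spectral)
qed

section \<open>Composite indices, the maximally mixed factor and block partial traces\<close>

lemma mult_add_less: "a < m \<Longrightarrow> b < n \<Longrightarrow> a * n + b < m * (n::nat)"
proof -
  assume "a < m" "b < n"
  then have "a * n + b < Suc a * n" by simp
  also have "\<dots> \<le> m * n" using \<open>a < m\<close> by (intro mult_le_mono1) simp
  finally show ?thesis .
qed

lemma sum_lessThan_mult: "(\<Sum>i<m * n. f i) = (\<Sum>a<m. \<Sum>b<n. f (a * n + b :: nat))"
proof -
  have "(\<Sum>i<m * n. f i) = (\<Sum>a<m. sum f {a * n..<a * n + n})"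
    by (simp add: sum.nat_group)
  also have "\<dots> = (\<Sum>a<m. \<Sum>b<n. f (a * n + b))"
    by (simp add: sum.atLeastLessThan_shift_0 atLeast0LessThan add.commute)
  finally show ?thesis .
qed

text \<open>The eigenvectors are u_a tensored with standard basis vectors, so every eigenvalue p_a
  of A becomes d copies of p_a / d.\<close>

lemma vn_entropy_tensor_maxmixed:
  assumes "density_operator n A" and d: "d > 0"
  shows "vn_entropy (tensor_maxmixed d A) = vn_entropy A + ln (real d)"
proof -
  obtain p u where sp: "spectral n A p u" and p: "\<And>k. k < n \<Longrightarrow> p k \<ge> 0" and p1: "sum p {..<n} = 1"
    using density_spectral[OF assms(1)] by blast
  have A: "A \<in> carrier_mat n n" using sp unfolding spectral_def by blast
  \<comment> \<open>An eigenvector label k encodes the pair (k div d, k mod d), matching the index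
    layout of \<open>tensor_maxmixed\<close>.\<close>
  define q where "q k = p (k div d) / real d" for k
  define w where "w k i = u (k div d) (i div d) * (if k mod d = i mod d then 1 else 0)" for k i
  have div_less: "k div d < n" if "k < n * d" for k using that by (simp add: less_mult_imp_div_less)
  have "spectral (n * d) (tensor_maxmixed d A) q w"
    unfolding spectral_def orthonormal_def
  proof (intro conjI ballI allI impI)
    fix k l assume "k \<in> {..<n * d}" "l \<in> {..<n * d}"
    then have kl: "k div d < n" "l div d < n" using div_less by auto
    have "(\<Sum>i<n * d. w k i * cnj (w l i))
        = (\<Sum>a<n. \<Sum>b<d. if b = k mod d then (if k mod d = l mod d then u (k div d) a * cnj (u (l div d) a) else 0) else 0)"
      unfolding sum_lessThan_mult w_def using d by (intro sum.cong refl) auto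
    also have "\<dots> = (if k mod d = l mod d then \<Sum>a<n. u (k div d) a * cnj (u (l div d) a) else 0)"
      using d by simp
    also have "\<dots> = (if k mod d = l mod d \<and> k div d = l div d then 1 else 0)"
      using onbD(1)[OF spectral_onb[OF sp]] kl by simp
    also have "k mod d = l mod d \<and> k div d = l div d \<longleftrightarrow> k = l"
      by (metis div_mult_mod_eq)
    finally show "(\<Sum>i<n * d. w k i * cnj (w l i)) = (if k = l then 1 else 0)" .
  next
    fix i j assume ij: "i < n * d" "j < n * d"
    have "(\<Sum>k<n * d. of_real (q k) * w k i * cnj (w k j))
        = (\<Sum>a<n. \<Sum>b<d. if b = i mod d then (if i mod d = j mod d then
            of_real (p a) * u a (i div d) * cnj (u a (j div d)) / of_nat d else 0) else 0)"
      unfolding sum_lessThan_mult w_def q_def using d by (intro sum.cong refl) auto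
    also have "\<dots> = (if i mod d = j mod d then (\<Sum>a<n. of_real (p a) * u a (i div d) * cnj (u a (j div d))) / of_nat d else 0)"
      using d by (simp add: sum_divide_distrib)
    also have "\<dots> = tensor_maxmixed d A $$ (i, j)"
      unfolding tensor_maxmixed_def using A ij spectralD[OF sp div_less div_less] by simp
    finally show "tensor_maxmixed d A $$ (i, j) = (\<Sum>k<n * d. of_real (q k) * w k i * cnj (w k j))" by simp
  qed (use A in \<open>auto simp: tensor_maxmixed_def\<close>)
  from vn_entropy_spectral[OF this]
  have "vn_entropy (tensor_maxmixed d A) = (\<Sum>a<n. \<Sum>b<d. eta (p a / real d))"
    unfolding sum_lessThan_mult q_def using d by simp
  also have "\<dots> = (\<Sum>a<n. eta (p a) + p a * ln (real d))"
  proof (intro sum.cong refl)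
    fix a assume "a \<in> {..<n}"
    then have "p a \<ge> 0" using p by simp
    then show "(\<Sum>b<d. eta (p a / real d)) = eta (p a) + p a * ln (real d)"
      using d by (cases "p a = 0") (auto simp: eta_eq ln_div field_simps)
  qed
  also have "\<dots> = vn_entropy A + ln (real d)"
    using p1 by (simp add: vn_entropy_spectral[OF sp] sum.distrib flip: sum_distrib_right)
  finally show ?thesis .
qed

text \<open>
  Indices below $L M W$ are read as triples: $(x M + a) W + y$ stands for $(x, a, y)$, and the two outer
  components are traced out.
\<close>

definition block_trace :: "nat \<Rightarrow> nat \<Rightarrow> nat \<Rightarrow> complex mat \<Rightarrow> complex mat" where
  "block_trace L M W A = mat M M (\<lambda>(a, b).
     \<Sum>x<L. \<Sum>y<W. A $$ ((x * M + a) * W + y, (x * M + b) * W + y))"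

lemma density_block_trace:
  assumes "density_operator (L * M * W) A"
  shows "density_operator M (block_trace L M W A)"
proof -
  let ?N = "L * M * W"
  obtain p u where sp: "spectral ?N A p u" and p: "\<And>k. k < ?N \<Longrightarrow> p k \<ge> 0"
    using density_spectral[OF assms] by blast
  have idx: "(x * M + a) * W + y < ?N" if "x < L" "a < M" "y < W" for x a y
    using that by (intro mult_add_less) auto
  \<comment> \<open>Cutting each eigenvector at every value (x, y) of the traced-out components
    exhibits the partial trace as a mixture of slices.\<close>
  show ?thesis
  proof (rule density_of_ensemble[where T = "{..<L} \<times> {..<W} \<times> {..<?N}"
        and r = "\<lambda>(x, y, k). p k" and g = "\<lambda>(x, y, k) a. u k ((x * M + a) * W + y)"])
    fix a b assume ab: "a < M" "b < M"
    then have "block_trace L M W A $$ (a, b)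
        = (\<Sum>x<L. \<Sum>y<W. A $$ ((x * M + a) * W + y, (x * M + b) * W + y))"
      by (simp add: block_trace_def)
    also have "\<dots> = (\<Sum>x<L. \<Sum>y<W. \<Sum>k<?N. of_real (p k) * u k ((x * M + a) * W + y) * cnj (u k ((x * M + b) * W + y)))"
      by (intro sum.cong refl spectralD[OF sp] idx) (use ab in auto)
    finally show "block_trace L M W A $$ (a, b) = (\<Sum>t\<in>{..<L} \<times> {..<W} \<times> {..<?N}.
        of_real (case t of (x, y, k) \<Rightarrow> p k) * (case t of (x, y, k) \<Rightarrow> \<lambda>a. u k ((x * M + a) * W + y)) a
        * cnj ((case t of (x, y, k) \<Rightarrow> \<lambda>a. u k ((x * M + a) * W + y)) b))"
      by (simp add: sum.cartesian_product case_prod_beta)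
  next
    have "(\<Sum>a<M. block_trace L M W A $$ (a, a))
        = (\<Sum>a<M. \<Sum>x<L. \<Sum>y<W. A $$ ((x * M + a) * W + y, (x * M + a) * W + y))"
      by (simp add: block_trace_def)
    also have "\<dots> = (\<Sum>i<?N. A $$ (i, i))"
      unfolding sum_lessThan_mult by (rule sum.swap)
    also have "\<dots> = 1" using assms unfolding density_operator_def by blast
    finally show "(\<Sum>a<M. block_trace L M W A $$ (a, a)) = 1" .
  qed (use p in \<open>auto simp: block_trace_def\<close>)
qed

lemma block_trace_prefix_index:
  "a < M \<Longrightarrow> b < M \<Longrightarrow> block_trace 1 M W A $$ (a, b) = (\<Sum>y<W. A $$ (a * W + y, b * W + y))"
  by (simp add: block_trace_def)

lemma block_trace_prefix_prefix:
  "block_trace 1 M W (block_trace 1 (M * W) V A) = block_trace 1 M (W * V) A"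
proof (rule eq_matI)
  fix a b assume "a < dim_row (block_trace 1 M (W * V) A)" "b < dim_col (block_trace 1 M (W * V) A)"
  then have ab: "a < M" "b < M" by (auto simp: block_trace_def)
  then show "block_trace 1 M W (block_trace 1 (M * W) V A) $$ (a, b) = block_trace 1 M (W * V) A $$ (a, b)"
    unfolding block_trace_prefix_index[OF ab] sum_lessThan_mult
    by (intro sum.cong refl) (simp add: block_trace_prefix_index[unfolded One_nat_def] mult_add_less add_mult_distrib add.assoc mult.assoc)
qed (auto simp: block_trace_def)

lemma block_trace_suffix_prefix:
  "block_trace L M 1 (block_trace 1 (L * M) W A) = block_trace L M W A"
proof (rule eq_matI)
  fix a b assume "a < dim_row (block_trace L M W A)" "b < dim_col (block_trace L M W A)"
  then have ab: "a < M" "b < M" by (auto simp: block_trace_def)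
  then show "block_trace L M 1 (block_trace 1 (L * M) W A) $$ (a, b) = block_trace L M W A $$ (a, b)"
    by (simp add: block_trace_def mult_add_less)
qed (auto simp: block_trace_def)

lemma araki_lieb:
  assumes A: "density_operator (M * W) A"
  shows "vn_entropy (block_trace 1 M W A) \<le> vn_entropy (block_trace M W 1 A) + vn_entropy A"
    and "vn_entropy (block_trace M W 1 A) \<le> vn_entropy (block_trace 1 M W A) + vn_entropy A"
proof -
  let ?N = "M * W" and ?P = "block_trace 1 M W A" and ?Q = "block_trace M W 1 A"
  obtain p u where sp: "spectral ?N A p u" and p: "\<And>k. k < ?N \<Longrightarrow> p k \<ge> 0" and p1: "sum p {..<?N} = 1"
    using density_spectral[OF A] by blast
  obtain \<alpha> v where sv: "spectral M ?P \<alpha> v" and \<alpha>: "\<And>k. k < M \<Longrightarrow> \<alpha> k \<ge> 0"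
    using density_spectral[OF density_block_trace[of 1 M W A]] A by (simp only: mult_1) blast
  obtain \<beta> w where sw: "spectral W ?Q \<beta> w" and \<beta>: "\<And>k. k < W \<Longrightarrow> \<beta> k \<ge> 0"
    using density_spectral[OF density_block_trace[of M W 1 A]] A by (simp only: mult_1_right) blast
  \<comment> \<open>An eigenvector on the composite index reshaped into a function of its two
    components.\<close>
  define \<psi> where "\<psi> k a b = u k (a * W + b)" for k a b
  have nrm: "(\<Sum>a<M. \<Sum>b<W. \<psi> k a b * cnj (\<psi> k a b)) = 1" if "k < ?N" for k
    using onbD(1)[OF spectral_onb[OF sp], of k k] that unfolding \<psi>_def sum_lessThan_mult by simp
  have A\<psi>: "A $$ (a * W + b, a' * W + b') = (\<Sum>k<?N. of_real (p k) * (\<psi> k a b * cnj (\<psi> k a' b')))"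
    if "a < M" "b < W" "a' < M" "b' < W" for a b a' b'
    using spectralD[OF sp mult_add_less[OF that(1,2)] mult_add_less[OF that(3,4)]]
    unfolding \<psi>_def by (simp add: mult.assoc)
  have rA: "(\<Sum>k<?N. of_real (p k) * (\<Sum>b<W. \<psi> k a b * cnj (\<psi> k a' b))) = (\<Sum>i<M. of_real (\<alpha> i) * v i a * cnj (v i a'))"
    if "a < M" "a' < M" for a a'
  proof -
    have "(\<Sum>k<?N. of_real (p k) * (\<Sum>b<W. \<psi> k a b * cnj (\<psi> k a' b))) = (\<Sum>b<W. A $$ (a * W + b, a' * W + b))"
      unfolding sum_distrib_left by (subst sum.swap) (intro sum.cong refl A\<psi>[symmetric], use that in auto)
    also have "\<dots> = ?P $$ (a, a')" using that by (simp add: block_trace_def)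
    finally show ?thesis using spectralD[OF sv that] by simp
  qed
  have rB: "(\<Sum>k<?N. of_real (p k) * (\<Sum>a<M. \<psi> k a b * cnj (\<psi> k a b'))) = (\<Sum>j<W. of_real (\<beta> j) * w j b * cnj (w j b'))"
    if "b < W" "b' < W" for b b'
  proof -
    have "(\<Sum>k<?N. of_real (p k) * (\<Sum>a<M. \<psi> k a b * cnj (\<psi> k a b'))) = (\<Sum>a<M. A $$ (a * W + b, a * W + b'))"
      unfolding sum_distrib_left by (subst sum.swap) (intro sum.cong refl A\<psi>[symmetric], use that in auto)
    also have "\<dots> = ?Q $$ (b, b')" using that by (simp add: block_trace_def)
    finally show ?thesis using spectralD[OF sw that] by simp
  qed
  show "vn_entropy ?P \<le> vn_entropy ?Q + vn_entropy A"
    unfolding vn_entropy_spectral[OF sp] vn_entropy_spectral[OF sv] vn_entropy_spectral[OF sw]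
    by (rule araki_lieb_eigenvalues[where \<psi> = \<psi> and A = "{..<M}" and B = "{..<W}" and u = v and w = w])
      (simp_all only: nrm p p1 \<alpha> rA rB spectral_onb[OF sv] spectral_onb[OF sw] lessThan_iff finite_lessThan)
  show "vn_entropy ?Q \<le> vn_entropy ?P + vn_entropy A"
    unfolding vn_entropy_spectral[OF sp] vn_entropy_spectral[OF sv] vn_entropy_spectral[OF sw]
  \<comment> \<open>The same inequality with the roles of the subsystems exchanged.\<close>
  proof (rule araki_lieb_eigenvalues[where \<psi> = "\<lambda>k b a. \<psi> k a b" and A = "{..<W}" and B = "{..<M}" and u = w and w = v])
    show "(\<Sum>b<W. \<Sum>a<M. \<psi> k a b * cnj (\<psi> k a b)) = 1" if "k \<in> {..<?N}" for k
      using nrm[of k] that by (subst sum.swap) simp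
  qed (simp_all only: p p1 \<beta> rA rB spectral_onb[OF sv] spectral_onb[OF sw] lessThan_iff finite_lessThan)
qed

section \<open>Marginals on intervals of factors\<close>

lemma digit_sum_eq_mod:
  fixes d :: nat
  shows "(\<Sum>p<n. x div d ^ p mod d * d ^ p) = x mod d ^ n"
  by (induction n) (auto simp: mod_mult2_eq mult.commute[of d])

lemma digits_eq_iff_mod_eq:
  fixes d :: nat
  assumes "d > 0"
  shows "(\<forall>p<n. x div d ^ p mod d = y div d ^ p mod d) \<longleftrightarrow> x mod d ^ n = y mod d ^ n"
proof
  assume "\<forall>p<n. x div d ^ p mod d = y div d ^ p mod d"
  then have "(\<Sum>p<n. x div d ^ p mod d * d ^ p) = (\<Sum>p<n. y div d ^ p mod d * d ^ p)" by simp
  then show "x mod d ^ n = y mod d ^ n" by (simp add: digit_sum_eq_mod)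
next
  assume xy: "x mod d ^ n = y mod d ^ n"
  have digit_mod: "z mod d ^ n div d ^ p mod d = z div d ^ p mod d" if "p < n" for z p
  proof -
    have "d ^ n = d ^ p * (d * d ^ (n - Suc p))"
      using that by (metis Suc_le_eq le_add_diff_inverse mult.assoc power_Suc2 power_add)
    then have "z mod d ^ n = d ^ p * (z div d ^ p mod (d * d ^ (n - Suc p))) + z mod d ^ p"
      by (simp add: mod_mult2_eq)
    then have "z mod d ^ n div d ^ p = z div d ^ p mod (d * d ^ (n - Suc p))"
      using assms by simp
    then show ?thesis by (simp add: mod_mult2_eq)
  qed
  show "\<forall>p<n. x div d ^ p mod d = y div d ^ p mod d"
    using digit_mod[of _ x] digit_mod[of _ y] xy by metis
qed

text \<open>Factor q carries the power k - 1 - q of d, so an interval of factors is a block of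
  consecutive digits, extracted by one division and one remainder.\<close>

lemma restrict_idx_interval:
  assumes "l \<le> m" "m \<le> k"
  shows "restrict_idx d k {l..<m} i = i div d ^ (k - m) mod d ^ (m - l)"
proof -
  have "restrict_idx d k {l..<m} i = (\<Sum>j<m - l. i div d ^ (k - 1 - (l + j)) mod d * d ^ (m - l - 1 - j))"
    unfolding restrict_idx_def digit_def by (simp add: Let_def)
  \<comment> \<open>Reversing the sum passes from most significant digit first to least significant
    first.\<close>
  also have "\<dots> = (\<Sum>j<m - l. i div d ^ (k - 1 - (l + (m - l - Suc j))) mod d * d ^ (m - l - 1 - (m - l - Suc j)))"
    by (rule sum.nat_diff_reindex[symmetric])
  also have "\<dots> = (\<Sum>j<m - l. i div d ^ (k - m) div d ^ j mod d * d ^ j)"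
  proof (intro sum.cong refl)
    fix j assume "j \<in> {..<m - l}"
    then have "k - 1 - (l + (m - l - Suc j)) = (k - m) + j" "m - l - 1 - (m - l - Suc j) = j"
      using assms by auto
    then show "i div d ^ (k - 1 - (l + (m - l - Suc j))) mod d * d ^ (m - l - 1 - (m - l - Suc j))
      = i div d ^ (k - m) div d ^ j mod d * d ^ j"
      by (simp add: power_add div_mult2_eq)
  qed
  finally show ?thesis by (simp add: digit_sum_eq_mod)
qed

text \<open>Factors before l are the leading digits, recorded by a quotient; factors from m on are
  the trailing digits, recorded by a remainder.\<close>

lemma digits_outside_interval_eq_iff:
  assumes lm: "l \<le> m" "m \<le> k" and d: "d > 0" and ij: "i < d ^ k" "j < d ^ k"
  shows "(\<forall>q<k. q \<notin> {l..<m} \<longrightarrow> digit d k q i = digit d k q j) \<longleftrightarrow>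
    i div d ^ (k - l) = j div d ^ (k - l) \<and> i mod d ^ (k - m) = j mod d ^ (k - m)"
    (is "?lhs \<longleftrightarrow> ?rhs")
proof -
  have low: "(\<forall>q<k. m \<le> q \<longrightarrow> digit d k q i = digit d k q j) \<longleftrightarrow> i mod d ^ (k - m) = j mod d ^ (k - m)"
  proof -
    have "(\<forall>q<k. m \<le> q \<longrightarrow> digit d k q i = digit d k q j)
      \<longleftrightarrow> (\<forall>p<k - m. i div d ^ p mod d = j div d ^ p mod d)" (is "?a \<longleftrightarrow> ?b")
    proof
      assume a: ?a
      show ?b
      proof (intro allI impI)
        fix p assume p: "p < k - m"
        then have "k - 1 - p < k" "m \<le> k - 1 - p" "k - 1 - (k - 1 - p) = p" by auto
        then show "i div d ^ p mod d = j div d ^ p mod d" using a unfolding digit_def by metis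
      qed
    next
      assume b: ?b
      show ?a
      proof (intro allI impI)
        fix q assume "q < k" "m \<le> q"
        then have "k - 1 - q < k - m" by auto
        then show "digit d k q i = digit d k q j" using b unfolding digit_def by blast
      qed
    qed
    then show ?thesis using digits_eq_iff_mod_eq[OF d] by simp
  qed
  have high: "(\<forall>q<l. digit d k q i = digit d k q j) \<longleftrightarrow> i div d ^ (k - l) = j div d ^ (k - l)"
  proof -
    have "(\<forall>q<l. digit d k q i = digit d k q j)
      \<longleftrightarrow> (\<forall>p<l. i div d ^ (k - l) div d ^ p mod d = j div d ^ (k - l) div d ^ p mod d)" (is "?a \<longleftrightarrow> ?b")
    proof
      assume a: ?a
      show ?b
      proof (intro allI impI)
        fix p assume p: "p < l"
        then have "l - 1 - p < l" "k - 1 - (l - 1 - p) = (k - l) + p" using lm by auto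
        then show "i div d ^ (k - l) div d ^ p mod d = j div d ^ (k - l) div d ^ p mod d"
          using a unfolding digit_def by (metis div_mult2_eq power_add)
      qed
    next
      assume b: ?b
      show ?a
      proof (intro allI impI)
        fix q assume q: "q < l"
        then have "l - 1 - q < l" "k - 1 - q = (k - l) + (l - 1 - q)" using lm by auto
        then show "digit d k q i = digit d k q j"
          using b unfolding digit_def by (metis div_mult2_eq power_add)
      qed
    qed
    also have "\<dots> \<longleftrightarrow> i div d ^ (k - l) mod d ^ l = j div d ^ (k - l) mod d ^ l"
      by (rule digits_eq_iff_mod_eq[OF d])
    also have "\<dots> \<longleftrightarrow> i div d ^ (k - l) = j div d ^ (k - l)"
    proof -
      have "d ^ k = d ^ l * d ^ (k - l)" using lm by (simp flip: power_add)
      then have "i div d ^ (k - l) < d ^ l" "j div d ^ (k - l) < d ^ l"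
        using ij by (auto simp: less_mult_imp_div_less)
      then show ?thesis by simp
    qed
    finally show ?thesis .
  qed
  have "?lhs \<longleftrightarrow> (\<forall>q<l. digit d k q i = digit d k q j) \<and> (\<forall>q<k. m \<le> q \<longrightarrow> digit d k q i = digit d k q j)"
    using lm by (auto simp: not_le)
  then show ?thesis unfolding low high .
qed

text \<open>This bridges the digit-based definition and block arithmetic. The index pairs that
  survive the conditions in \<open>marginal\<close> correspond bijectively to the values (x, y) of
  the traced-out leading and trailing blocks.\<close>

lemma marginal_interval:
  assumes lm: "l \<le> m" "m \<le> k" and d: "d > 0"
  shows "marginal d k {l..<m} A = block_trace (d ^ l) (d ^ (m - l)) (d ^ (k - m)) A"
proof (rule eq_matI)
  let ?L = "d ^ l" and ?M = "d ^ (m - l)" and ?W = "d ^ (k - m)"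
  fix a b assume "a < dim_row (block_trace ?L ?M ?W A)" "b < dim_col (block_trace ?L ?M ?W A)"
  then have ab: "a < ?M" "b < ?M" by (auto simp: block_trace_def)
  have dk: "d ^ k = ?L * ?M * ?W" and dkl: "d ^ (k - l) = ?W * ?M" using lm by (auto simp flip: power_add)
  define S where "S = {(i, j). i < d ^ k \<and> j < d ^ k \<and> i div ?W mod ?M = a \<and> j div ?W mod ?M = b
     \<and> i div (?W * ?M) = j div (?W * ?M) \<and> i mod ?W = j mod ?W}"
  have S_iff: "restrict_idx d k {l..<m} i = a \<and> restrict_idx d k {l..<m} j = b \<and>
      (\<forall>q<k. q \<notin> {l..<m} \<longrightarrow> digit d k q i = digit d k q j) \<longleftrightarrow> (i, j) \<in> S"
    if "i < d ^ k" "j < d ^ k" for i j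
    unfolding restrict_idx_interval[OF lm] digits_outside_interval_eq_iff[OF lm d that]
    using that by (simp add: S_def dkl)
  have "marginal d k {l..<m} A $$ (a, b) = (\<Sum>i<d ^ k. \<Sum>j<d ^ k.
      if restrict_idx d k {l..<m} i = a \<and> restrict_idx d k {l..<m} j = b \<and>
        (\<forall>q<k. q \<notin> {l..<m} \<longrightarrow> digit d k q i = digit d k q j) then A $$ (i, j) else 0)"
    unfolding marginal_def using ab by (simp only: index_mat split card_atLeastLessThan)
  also have "\<dots> = (\<Sum>i<d ^ k. \<Sum>j<d ^ k. if (i, j) \<in> S then A $$ (i, j) else 0)"
    by (intro sum.cong refl if_cong S_iff) auto
  also have "\<dots> = (\<Sum>ij\<in>S. A $$ ij)"
  proof -
    have "S = {ij \<in> {..<d ^ k} \<times> {..<d ^ k}. ij \<in> S}" unfolding S_def by auto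
    then have "(\<Sum>ij\<in>S. A $$ ij) = (\<Sum>ij\<in>{..<d ^ k} \<times> {..<d ^ k}. if ij \<in> S then A $$ ij else 0)"
      by (subst sum.inter_filter[symmetric]) auto
    then show ?thesis by (simp only: sum.cartesian_product) (intro sum.cong refl, auto)
  qed
  also have "\<dots> = (\<Sum>(x, y)\<in>{..<?L} \<times> {..<?W}. A $$ ((x * ?M + a) * ?W + y, (x * ?M + b) * ?W + y))"
  proof (rule sum.reindex_bij_witness[where i = "\<lambda>(x, y). ((x * ?M + a) * ?W + y, (x * ?M + b) * ?W + y)"
        and j = "\<lambda>(i, j). (i div (?W * ?M), i mod ?W)"])
    have decomp: "(i div (?W * ?M) * ?M + i div ?W mod ?M) * ?W + i mod ?W = i" for i
      by (simp only: div_mult2_eq div_mult_mod_eq)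
    fix ij assume "ij \<in> S"
    then obtain i j where ij: "ij = (i, j)" "i < d ^ k" "i div ?W mod ?M = a" "j div ?W mod ?M = b"
     "i div (?W * ?M) = j div (?W * ?M)" "i mod ?W = j mod ?W" unfolding S_def by auto
    show eq: "(case case ij of (i, j) \<Rightarrow> (i div (?W * ?M), i mod ?W) of
        (x, y) \<Rightarrow> ((x * ?M + a) * ?W + y, (x * ?M + b) * ?W + y)) = ij"
      using decomp[of i] decomp[of j] ij by simp
    show "(case ij of (i, j) \<Rightarrow> (i div (?W * ?M), i mod ?W)) \<in> {..<?L} \<times> {..<?W}"
      using ij(1,2) d by (simp add: dk less_mult_imp_div_less mult_ac)
    show "(case case ij of (i, j) \<Rightarrow> (i div (?W * ?M), i mod ?W) of
        (x, y) \<Rightarrow> A $$ ((x * ?M + a) * ?W + y, (x * ?M + b) * ?W + y)) = A $$ ij"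
      using eq by (auto simp: case_prod_beta)
  next
    fix xy assume "xy \<in> {..<?L} \<times> {..<?W}"
    then obtain x y where xy: "xy = (x, y)" "x < ?L" "y < ?W" by auto
    have divmod: "(q * v + r) div v = q" "(q * v + r) mod v = r" if "r < v" for q r v :: nat
      using that by auto
    have dW: "((x * ?M + c) * ?W + y) div ?W = x * ?M + c" "((x * ?M + c) * ?W + y) mod ?W = y" for c
      using divmod[OF xy(3)] by simp_all
    have dM: "(x * ?M + c) div ?M = x" "(x * ?M + c) mod ?M = c" if "c < ?M" for c
      using divmod[OF that] by simp_all
    have less: "(x * ?M + c) * ?W + y < d ^ k" if "c < ?M" for c
      unfolding dk using xy that by (intro mult_add_less) auto
    show "(case case xy of (x, y) \<Rightarrow> ((x * ?M + a) * ?W + y, (x * ?M + b) * ?W + y) of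
        (i, j) \<Rightarrow> (i div (?W * ?M), i mod ?W)) = xy"
      unfolding xy using dW[of a] dM[OF ab(1)] by (simp only: split div_mult2_eq)
    show "(case xy of (x, y) \<Rightarrow> ((x * ?M + a) * ?W + y, (x * ?M + b) * ?W + y)) \<in> S"
      unfolding xy S_def
      by (simp only: split mem_Collect_eq div_mult2_eq dW dM[OF ab(1)] dM[OF ab(2)] less[OF ab(1)] less[OF ab(2)] simp_thms)
  qed
  also have "\<dots> = block_trace ?L ?M ?W A $$ (a, b)"
    using ab by (simp add: block_trace_def sum.cartesian_product)
  finally show "marginal d k {l..<m} A $$ (a, b) = block_trace ?L ?M ?W A $$ (a, b)" .
qed (auto simp: marginal_def block_trace_def)

section \<open>Process tensors\<close>

lemma block_trace_trivial: "A \<in> carrier_mat n n \<Longrightarrow> block_trace 1 n 1 A = A"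
  by (rule eq_matI) (auto simp: block_trace_def)

lemma density_marginal_interval:
  assumes "density_operator (d ^ k) A" "l \<le> m" "m \<le> k" "d > 0"
  shows "density_operator (d ^ (m - l)) (marginal d k {l..<m} A)"
  unfolding marginal_interval[OF assms(2-4)]
  by (rule density_block_trace) (use assms in \<open>simp flip: power_add\<close>)

lemma marginal_full:
  assumes "density_operator (d ^ k) A" "d > 0"
  shows "marginal d k {0..<k} A = A"
proof -
  have "A \<in> carrier_mat (d ^ k) (d ^ k)" using assms(1) unfolding density_operator_def by blast
  then show ?thesis using marginal_interval[of 0 k k d A] block_trace_trivial assms(2) by simp
qed

lemma marginal_interval_marginal_prefix:
  assumes "l \<le> m" "m \<le> k" "d > 0"
  shows "marginal d m {l..<m} (marginal d k {0..<m} A) = marginal d k {l..<m} A"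
  using assms block_trace_suffix_prefix[of "d ^ l" "d ^ (m - l)" "d ^ (k - m)" A]
  by (simp add: marginal_interval flip: power_add)

text \<open>\<open>process_tensor\<close> takes a marginal of \<open>ups_upto\<close>, viewed as an
  operator on 2 j factors. Collapsing nested marginals makes it a condition on the full
  operator.\<close>

lemma marginal_prefix_marginal_prefix:
  assumes "l \<le> m" "m \<le> k" "d > 0"
  shows "marginal d m {0..<l} (marginal d k {0..<m} A) = marginal d k {0..<l} A"
  using assms block_trace_prefix_prefix[of "d ^ l" "d ^ (m - l)" "d ^ (k - m)" A]
  by (simp add: marginal_interval flip: power_add)

lemma araki_lieb_marginal:
  assumes A: "density_operator (d ^ k) A" and "l \<le> m" "m \<le> k" "d > 0"
  shows "vn_entropy (marginal d k {0..<l} A)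
      \<le> vn_entropy (marginal d k {l..<m} A) + vn_entropy (marginal d k {0..<m} A)"
    and "vn_entropy (marginal d k {l..<m} A)
      \<le> vn_entropy (marginal d k {0..<l} A) + vn_entropy (marginal d k {0..<m} A)"
proof -
  let ?B = "marginal d k {0..<m} A"
  have "density_operator (d ^ l * d ^ (m - l)) ?B"
    using density_marginal_interval[OF A, of 0 m] assms by (simp flip: power_add)
  note * = araki_lieb[OF this]
  have "block_trace 1 (d ^ l) (d ^ (m - l)) ?B = marginal d k {0..<l} A"
    using marginal_prefix_marginal_prefix[OF assms(2-4), of A] marginal_interval[of 0 l m d ?B] assms by simp
  moreover have "block_trace (d ^ l) (d ^ (m - l)) 1 ?B = marginal d k {l..<m} A"
    using marginal_interval_marginal_prefix[OF assms(2-4), of A] marginal_interval[of l m m d ?B] assms by simp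
  ultimately show "vn_entropy (marginal d k {0..<l} A) \<le> vn_entropy (marginal d k {l..<m} A) + vn_entropy ?B"
    and "vn_entropy (marginal d k {l..<m} A) \<le> vn_entropy (marginal d k {0..<l} A) + vn_entropy ?B"
    using * by simp_all
qed

lemma prefix_entropy_mono:
  assumes pt: "process_tensor d n A" and d: "d > 0" and i: "1 \<le> i" "i < n"
  shows "vn_entropy (ups_upto d n A i) \<le> vn_entropy (ups_upto d n A (Suc i))"
proof -
  have A: "density_operator (d ^ (2 * n)) A" using pt unfolding process_tensor_def by blast
  let ?m = "2 * i + 1"
  have dens: "density_operator (d ^ (2 * i)) (ups_upto d n A i)"
    unfolding ups_upto_def using density_marginal_interval[OF A, of 0 "2 * i"] i d by simp
  \<comment> \<open>The output of step i + 1 is factor 2 i + 1, the last one of the prefix, so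
    removing it leaves the past together with the input of that step.\<close>
  have without_out: "{0..<2 * Suc i} - {out_fac (Suc i)} = {0..<?m}" unfolding out_fac_def by auto
  have "Suc i \<in> {1..n}" using i by simp
  with pt have "marginal d (2 * Suc i) ({0..<2 * Suc i} - {out_fac (Suc i)}) (ups_upto d n A (Suc i))
      = tensor_maxmixed d (if Suc i = 1 then 1\<^sub>m 1 else ups_upto d n A (Suc i - 1))"
    unfolding process_tensor_def by blast
  then have "marginal d (2 * Suc i) {0..<?m} (ups_upto d n A (Suc i)) = tensor_maxmixed d (ups_upto d n A i)"
    unfolding without_out using i by simp
  then have "marginal d (2 * n) {0..<?m} A = tensor_maxmixed d (ups_upto d n A i)"
    using marginal_prefix_marginal_prefix[of ?m "2 * Suc i" "2 * n" d A] i d unfolding ups_upto_def by simp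
  then have "vn_entropy (ups_upto d n A i) + ln (real d) = vn_entropy (marginal d (2 * n) {0..<?m} A)"
    using vn_entropy_tensor_maxmixed[OF dens d] by simp
  \<comment> \<open>Araki-Lieb for the cut between that shorter prefix and the single output
    factor.\<close>
  also have "\<dots> \<le> vn_entropy (marginal d (2 * n) {?m..<2 * Suc i} A) + vn_entropy (ups_upto d n A (Suc i))"
    unfolding ups_upto_def by (rule araki_lieb_marginal(1)[OF A]) (use i d in auto)
  also have "vn_entropy (marginal d (2 * n) {?m..<2 * Suc i} A) \<le> ln (real d)"
    using vn_entropy_le_ln_dim[OF density_marginal_interval[OF A, of ?m "2 * Suc i"]] i d by simp
  finally show ?thesis by simp
qed

theorem theorem2:
  fixes n d :: nat and \<Upsilon> :: "complex mat"
  assumes "n \<ge> 2" and "d \<ge> 2" and "process_tensor d n \<Upsilon>"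
  shows "markov_corr d n \<Upsilon>
           \<le> 2 * real n * ln (real d)
              - (2 ^ n - 1) / (2 ^ n - 2) * nonmarkov_corr d n \<Upsilon>"
proof -
  have d: "d > 0" using assms(2) by simp
  have dens: "density_operator (d ^ (2 * n)) \<Upsilon>"
    using assms(3) unfolding process_tensor_def by blast
  define T where "T j = vn_entropy (ups_upto d n \<Upsilon> j)" for j
  define s where "s j = ent d n \<Upsilon> {in_fac (j - 1), out_fac j}" for j
  let ?S = "vn_entropy \<Upsilon>" and ?N = "nonmarkov_corr d n \<Upsilon>"
  have S0: "?S \<ge> 0" by (rule vn_entropy_nonneg[OF dens])
  have Tn: "T n = ?S" unfolding T_def ups_upto_def by (simp only: marginal_full[OF dens d])
  have T_le: "T j \<le> ?S" if "1 \<le> j" "j \<le> n" for j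
    \<comment> \<open>Monotonicity is run downwards from j = n, where the prefix is all of
      \<Upsilon>.\<close>
    using that(2,1)
  proof (induction rule: inc_induct)
    case base
    then show ?case using Tn by simp
  next
    case (step i)
    then show ?case using prefix_entropy_mono[OF assms(3) d, of i] unfolding T_def by simp
  qed
  have s_interval: "s j = vn_entropy (marginal d (2 * n) {2 * (j - 1)..<2 * j} \<Upsilon>)" if "1 \<le> j" for j
  proof -
    have "{in_fac (j - 1), out_fac j} = {2 * (j - 1)..<2 * j}"
      using that unfolding in_fac_def out_fac_def by auto
    then show ?thesis unfolding s_def ent_def by simp
  qed
  \<comment> \<open>The first step is itself a prefix, so it costs one total entropy where each
    later step costs two.\<close>
  have s1: "s 1 \<le> ?S"
    using s_interval[of 1] T_le[of 1] assms(1) unfolding T_def ups_upto_def by simp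
  have sj: "s j \<le> 2 * ?S" if "2 \<le> j" "j \<le> n" for j
  proof -
    have "s j \<le> T (j - 1) + T j"
      unfolding T_def ups_upto_def s_interval[OF order_trans[OF one_le_numeral that(1)]]
      by (rule araki_lieb_marginal(2)[OF dens]) (use that d in auto)
    moreover have "T j \<le> ?S" "T (j - 1) \<le> ?S" using that by (auto intro!: T_le)
    ultimately show ?thesis by simp
  qed
  have "?N = (\<Sum>j = 1..n. s j) - ?S" unfolding nonmarkov_corr_def s_def ..
  also have "(\<Sum>j = 1..n. s j) = s 1 + (\<Sum>j = 2..n. s j)"
    using assms(1) by (subst sum.atLeast_Suc_atMost) (auto simp: numeral_2_eq_2)
  also have "(\<Sum>j = 2..n. s j) \<le> real (card {2..n}) * (2 * ?S)"
    by (rule sum_bounded_above) (use sj in auto)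
  \<comment> \<open>Count: 1 for the first step, 2 for each of the n - 1 others, minus 1 for the
    total entropy, giving 2 n - 2.\<close>
  finally have "?N \<le> (2 * real n - 2) * ?S"
    using s1 assms(1) by (simp add: of_nat_diff algebra_simps)
  \<comment> \<open>The linear constant is relaxed to the exponential one of the claim; the two
    agree at n = 2.\<close>
  also have "\<dots> \<le> (2 ^ n - 2) * ?S"
  proof -
    have "2 * n \<le> 2 ^ n" using assms(1) by (induction n rule: nat_induct_at_least) auto
    then have "2 * real n \<le> 2 ^ n" by (metis of_nat_le_iff of_nat_mult of_nat_numeral of_nat_power)
    then show ?thesis using S0 by (intro mult_right_mono) auto
  qed
  finally have N_le: "?N \<le> (2 ^ n - 2) * ?S" .
  have single: "ent d n \<Upsilon> {m} \<le> ln (real d)" if "m < 2 * n" for m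
  proof -
    have "{m} = {m..<Suc m}" by auto
    then show ?thesis
      using vn_entropy_le_ln_dim[OF density_marginal_interval[OF dens, of m "Suc m"]] that d
      unfolding ent_def by simp
  qed
  \<comment> \<open>The step entropies cancel between the two correlations; single-factor entropies
    and the total entropy remain.\<close>
  have "markov_corr d n \<Upsilon> + ?N = (\<Sum>j = 1..n. ent d n \<Upsilon> {in_fac (j - 1)} + ent d n \<Upsilon> {out_fac j}) - ?S"
    unfolding markov_corr_def nonmarkov_corr_def by (simp add: sum_subtractf)
  also have "(\<Sum>j = 1..n. ent d n \<Upsilon> {in_fac (j - 1)} + ent d n \<Upsilon> {out_fac j}) \<le> real (card {1..n}) * (2 * ln (real d))"
  proof (rule sum_bounded_above)
    fix j assume "j \<in> {1..n}"
    then have "in_fac (j - 1) < 2 * n" "out_fac j < 2 * n" unfolding in_fac_def out_fac_def by auto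
    from single[OF this(1)] single[OF this(2)]
    show "ent d n \<Upsilon> {in_fac (j - 1)} + ent d n \<Upsilon> {out_fac j} \<le> 2 * ln (real d)" by simp
  qed
  finally have MN: "markov_corr d n \<Upsilon> + ?N \<le> 2 * real n * ln (real d) - ?S" by simp
  have pos: "(2::real) ^ n - 2 > 0"
    using power_strict_increasing[of 1 n "2::real"] assms(1) by simp
  then have "?N / (2 ^ n - 2) \<le> ?S" using N_le by (simp add: divide_le_eq mult.commute)
  \<comment> \<open>The coefficient exceeds 1 by 1 / (2^n - 2), and that excess times N is at most
    the total entropy, which is the slack in \<open>MN\<close>.\<close>
  moreover have "(2 ^ n - 1) / (2 ^ n - 2) * ?N = ?N + ?N / (2 ^ n - 2)"
  proof -
    have "(2 ^ n - 1) / (2 ^ n - 2 :: real) = 1 + 1 / (2 ^ n - 2)"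
      using pos by (simp add: field_simps)
    then show ?thesis by (simp add: distrib_right)
  qed
  ultimately show ?thesis using MN by linarith
qed

end
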